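(* Let $X=\{x_1,\ldots,x_n\}$, let $I\subset\mathbb{Z}[X]$ be a monomial ideal containing $x_1^2,\ldots,x_n^2$, let $A=(a_1,\ldots,a_r)$ be a spherical resolution of $I$, and suppose that for each $i\in[r]$, $a_i$ dominates $b_i$ in $I_i:=(I:a_1\cdots a_{i-1})$. Then there is a quasi-isomorphism $\varphi: Z\bigl(R(c(A))\bigr)\to Z\bigl(R(I)\bigr)$ of degree $r$. Furthermore $\varphi=\pi\circ\varphi'$, where $\pi$ is a map sending each face $\sigma$ to $\pm\sigma$ and $\varphi'(z)=\prod_{i=1}^r(a_i-b_i)\,z$ (with the convention that all terms containing a square are zero). For all orderings of the variables such that $a_1<b_1\le a_2<b_2\le\cdots\le a_r<b_r<x$ for all remaining variables $x$, $\pi$ is the identity map.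
   Context: $R(I)$ is the simplicial complex of monomials of $\mathbb{Z}[X]$ not in $I$ (square-free monomials identified with sets of variables; $1$ is the empty face). Simplicial chains of $R(I)$ are identified with $\mathbb{Z}[X]/I$: chains of dimension $i-1$ are the span of the (face) monomials of degree $i$; a chosen total order on the variables determines the simplicial boundary map. $Z(\Delta)$ denotes the module of cycles of $\Delta$. A quasi-isomorphism of degree $r$ is a morphism sending chains of degree $k$ to chains of degree $k+r$ and inducing an isomorphism in (reduced) homology. $(I:x)=\{m:xm\in I\}$. $R(I)$ is a cone with apex $a\in X$ if $(I:a)=(I,a)$, i.e. $a$ divides no minimal monomial generator of $I$ other than the $x_i^2$. $a$ dominates $b$ in $I$ if $R(I)$ is not a cone with apex $b$ but $R((I,a))$ is a cone with apex $b$. A sequence $A=(a_1,\ldots,a_r)$ of variables, with $I_i=(I:a_1\cdots a_{i-1})$ for $i\in[r+1]$, is a resolution of $I$ if for every $i\in[r]$, $a_i\notin I_i$ and either $R(I_i)$ is a cone with apex $a_i$ or some $b_i\in X$ is dominated by $a_i$ in $I_i$; its core is $c(A)=I_{r+1}$. $A$ is spherical if $R(I_i)$ is not a cone with apex $a_i$ for every $i\in[r]$.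
   Formalization: In the last sentence, the remaining variables x are taken to be the vertices of R(c(A)) other than b_r; with x ranging over all variables besides the a_i, b_i, the claim that π is the identity fails when some b_i (i<r) is still a vertex of R(c(A)). *)

theory Defs
  imports Complex_Main "HOL-Library.Poly_Mapping" "HOL-Algebra.Coset"
begin

text \<open>
  The variables are the elements of a finite type \<open>'x\<close>, so \<open>X = UNIV\<close>; the ring
  \<open>\<int>[X]\<close> consists of the finitely supported functions from exponent vectors to \<open>int\<close>,
  with the convolution product.
\<close>

type_synonym 'x mpoly = "('x \<Rightarrow>\<^sub>0 nat) \<Rightarrow>\<^sub>0 int"

definition monomial :: "('x \<Rightarrow>\<^sub>0 nat) \<Rightarrow> 'x mpoly" where
  "monomial m = Poly_Mapping.single m 1"

definition var :: "'x \<Rightarrow> 'x mpoly" where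
  "var x = monomial (Poly_Mapping.single x 1)"

definition face_exp :: "'x set \<Rightarrow> ('x \<Rightarrow>\<^sub>0 nat)" where
  "face_exp \<sigma> = (\<Sum>x\<in>\<sigma>. Poly_Mapping.single x 1)"

definition face_mon :: "'x set \<Rightarrow> 'x mpoly" where
  "face_mon \<sigma> = (\<Prod>x\<in>\<sigma>. var x)"


subsection \<open>Monomial ideals and the complexes \<open>R(I)\<close>\<close>

text \<open>An ideal is a submodule of the ring over itself.\<close>

definition ideal_gen :: "'x mpoly set \<Rightarrow> 'x mpoly set" where
  "ideal_gen S = module.span (*) S"

definition monomial_ideal :: "'x mpoly set \<Rightarrow> bool" where
  "monomial_ideal I \<longleftrightarrow> (\<exists>M. I = ideal_gen (monomial ` M))"

definition colon :: "'x mpoly set \<Rightarrow> 'x mpoly \<Rightarrow> 'x mpoly set" where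
  "colon I f = {g. f * g \<in> I}"

definition adjoin :: "'x mpoly set \<Rightarrow> 'x mpoly \<Rightarrow> 'x mpoly set" where
  "adjoin I f = ideal_gen (insert f I)"

text \<open>
  When \<open>I\<close> contains the squares of the variables, every monomial outside \<open>I\<close> is
  square-free, hence is \<open>face_mon \<sigma>\<close> for a unique set \<open>\<sigma>\<close>.
\<close>

definition R :: "'x mpoly set \<Rightarrow> 'x set set" where
  "R I = {\<sigma>. face_mon \<sigma> \<notin> I}"

definition cone_apex :: "'x mpoly set \<Rightarrow> 'x \<Rightarrow> bool" where
  "cone_apex I a \<longleftrightarrow> colon I (var a) = adjoin I (var a)"

definition dominates :: "'x mpoly set \<Rightarrow> 'x \<Rightarrow> 'x \<Rightarrow> bool" where
  "dominates I a b \<longleftrightarrow> \<not> cone_apex I b \<and> cone_apex (adjoin I (var a)) b"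


subsection \<open>Resolutions\<close>

text \<open>
  Indices start at \<open>0\<close>: \<open>step_ideal I as i\<close> is the colon ideal of \<open>I\<close> by the product of
  the first \<open>i\<close> members of \<open>as\<close>.
\<close>

definition step_ideal :: "'x mpoly set \<Rightarrow> 'x list \<Rightarrow> nat \<Rightarrow> 'x mpoly set" where
  "step_ideal I as i = colon I (\<Prod>j<i. var (as ! j))"

definition core :: "'x mpoly set \<Rightarrow> 'x list \<Rightarrow> 'x mpoly set" where
  "core I as = step_ideal I as (length as)"

definition resolution :: "'x mpoly set \<Rightarrow> 'x list \<Rightarrow> bool" where
  "resolution I as \<longleftrightarrow>
     (\<forall>i<length as. var (as ! i) \<notin> step_ideal I as i \<and>
        (cone_apex (step_ideal I as i) (as ! i) \<or>
         (\<exists>b. dominates (step_ideal I as i) (as ! i) b)))"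

definition spherical :: "'x mpoly set \<Rightarrow> 'x list \<Rightarrow> bool" where
  "spherical I as \<longleftrightarrow> (\<forall>i<length as. \<not> cone_apex (step_ideal I as i) (as ! i))"


subsection \<open>Simplicial chains, cycles and reduced homology\<close>

text \<open>
  The residue classes of the face monomials form a basis of \<open>\<int>[X]/I\<close>, and a chain is
  represented by the polynomial supported on face monomials in its class. Dimensions are
  integers; the empty face spans the chains of dimension \<open>-1\<close>, so the homology is reduced.
\<close>

definition chains :: "'x set set \<Rightarrow> 'x mpoly set" where
  "chains \<Delta> = {z. Poly_Mapping.keys z \<subseteq> face_exp ` \<Delta>}"

definition chains_dim :: "'x set set \<Rightarrow> int \<Rightarrow> 'x mpoly set" where
  "chains_dim \<Delta> d = chains {\<sigma> \<in> \<Delta>. int (card \<sigma>) = d + 1}"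

definition face_coeff :: "'x mpoly \<Rightarrow> 'x set \<Rightarrow> int" where
  "face_coeff z \<sigma> = Poly_Mapping.lookup z (face_exp \<sigma>)"

definition face_boundary :: "'x rel \<Rightarrow> 'x set \<Rightarrow> 'x mpoly" where
  "face_boundary ord \<sigma> =
     (\<Sum>x\<in>\<sigma>. (- 1) ^ card {y \<in> \<sigma>. (y, x) \<in> ord \<and> y \<noteq> x} * face_mon (\<sigma> - {x}))"

definition boundary :: "'x::finite rel \<Rightarrow> 'x mpoly \<Rightarrow> 'x mpoly" where
  "boundary ord z = (\<Sum>\<sigma>\<in>UNIV. of_int (face_coeff z \<sigma>) * face_boundary ord \<sigma>)"

definition cycles :: "'x::finite rel \<Rightarrow> 'x set set \<Rightarrow> 'x mpoly set" where
  "cycles ord \<Delta> = {z \<in> chains \<Delta>. boundary ord z = 0}"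

definition cycles_dim :: "'x::finite rel \<Rightarrow> 'x set set \<Rightarrow> int \<Rightarrow> 'x mpoly set" where
  "cycles_dim ord \<Delta> d = {z \<in> chains_dim \<Delta> d. boundary ord z = 0}"

definition boundaries_dim :: "'x::finite rel \<Rightarrow> 'x set set \<Rightarrow> int \<Rightarrow> 'x mpoly set" where
  "boundaries_dim ord \<Delta> d = boundary ord ` chains_dim \<Delta> (d + 1)"

definition add_group :: "'a::ab_group_add set \<Rightarrow> 'a monoid" where
  "add_group S = \<lparr>carrier = S, monoid.mult = (+), one = 0\<rparr>"

definition homology :: "'x::finite rel \<Rightarrow> 'x set set \<Rightarrow> int \<Rightarrow> 'x mpoly set monoid" where
  "homology ord \<Delta> d = add_group (cycles_dim ord \<Delta> d) Mod boundaries_dim ord \<Delta> d"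

definition homology_class ::
    "'x::finite rel \<Rightarrow> 'x set set \<Rightarrow> int \<Rightarrow> 'x mpoly \<Rightarrow> 'x mpoly set" where
  "homology_class ord \<Delta> d z =
     boundaries_dim ord \<Delta> d #>\<^bsub>add_group (cycles_dim ord \<Delta> d)\<^esub> z"

text \<open>
  A quasi-isomorphism of degree \<open>r\<close> between modules of cycles. The dimension \<open>d\<close> ranges over
  all integers, so the homology of \<open>\<Gamma>\<close> in dimensions below \<open>r - 1\<close> is forced to vanish.
\<close>

definition quasi_iso ::
    "'x::finite rel \<Rightarrow> nat \<Rightarrow> 'x set set \<Rightarrow> 'x set set \<Rightarrow> ('x mpoly \<Rightarrow> 'x mpoly) \<Rightarrow> bool" where
  "quasi_iso ord r \<Delta> \<Gamma> \<phi> \<longleftrightarrow>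
     \<phi> \<in> hom (add_group (cycles ord \<Delta>)) (add_group (cycles ord \<Gamma>)) \<and>
     (\<forall>d. \<phi> ` cycles_dim ord \<Delta> d \<subseteq> cycles_dim ord \<Gamma> (d + int r)) \<and>
     (\<forall>d. \<exists>h \<in> iso (homology ord \<Delta> d) (homology ord \<Gamma> (d + int r)).
        \<forall>z \<in> cycles_dim ord \<Delta> d.
          h (homology_class ord \<Delta> d z) = homology_class ord \<Gamma> (d + int r) (\<phi> z))"


subsection \<open>The maps of the theorem\<close>

definition drop_squares :: "'x::finite mpoly \<Rightarrow> 'x mpoly" where
  "drop_squares f = (\<Sum>\<sigma>\<in>UNIV. of_int (face_coeff f \<sigma>) * face_mon \<sigma>)"

definition cross_mult :: "'x::finite list \<Rightarrow> 'x list \<Rightarrow> 'x mpoly \<Rightarrow> 'x mpoly" where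
  "cross_mult as bs z = drop_squares ((\<Prod>i<length as. var (as ! i) - var (bs ! i)) * z)"

definition face_sign_map :: "'x set set \<Rightarrow> ('x mpoly \<Rightarrow> 'x mpoly) \<Rightarrow> bool" where
  "face_sign_map \<Delta> \<pi> \<longleftrightarrow>
     additive \<pi> \<and> (\<forall>\<sigma>\<in>\<Delta>. \<pi> (face_mon \<sigma>) = face_mon \<sigma> \<or> \<pi> (face_mon \<sigma>) = - face_mon \<sigma>)"

text \<open>
  The order condition \<open>a\<^sub>1 < b\<^sub>1 \<le> a\<^sub>2 < b\<^sub>2 \<le> \<dots> \<le> a\<^sub>r < b\<^sub>r < x\<close>, for all remaining
  variables \<open>x\<close>. The remaining variables are those that are still vertices of \<open>R(c(A))\<close>
  (other than \<open>b\<^sub>r\<close> itself): no \<open>a\<^sub>i\<close> is one of them, but some \<open>b\<^sub>i\<close> may be. Letting \<open>x\<close> range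
  over the variables distinct from all \<open>a\<^sub>i\<close> and \<open>b\<^sub>i\<close> would not do: if the facets of \<open>R(I)\<close> are
  \<open>b\<^sub>1a\<^sub>2b\<^sub>2c\<close>, \<open>a\<^sub>1b\<^sub>1b\<^sub>2c\<close>, \<open>a\<^sub>1b\<^sub>1a\<^sub>2\<close>, \<open>a\<^sub>1a\<^sub>2c\<close> and \<open>a\<^sub>1 < b\<^sub>1 < a\<^sub>2 < b\<^sub>2 < c\<close>, then the cycle
  \<open>b\<^sub>1 - c\<close> of \<open>R(c(A))\<close> is multiplied to a chain that is not a cycle.
\<close>

definition adapted_order :: "'x rel \<Rightarrow> 'x mpoly set \<Rightarrow> 'x list \<Rightarrow> 'x list \<Rightarrow> bool" where
  "adapted_order ord I as bs \<longleftrightarrow>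
     (\<forall>i<length as. (as ! i, bs ! i) \<in> ord \<and> as ! i \<noteq> bs ! i) \<and>
     (\<forall>i. Suc i < length as \<longrightarrow> (bs ! i, as ! Suc i) \<in> ord) \<and>
     (as \<noteq> [] \<longrightarrow> (\<forall>x. {x} \<in> R (core I as) \<and> x \<noteq> last bs \<longrightarrow> (last bs, x) \<in> ord))"

end

theory Submission
  imports Defs
begin

text \<open>
  Exterior multiplication \<open>W\<^sub>a\<close> by a vertex \<open>a\<close> (the polynomial product with the sign that the order
  of the variables dictates, squares being zero) satisfies \<open>\<partial>W\<^sub>a + W\<^sub>a\<partial> = 1\<close>. The complex
  \<open>R(I : a)\<close> is the link of \<open>a\<close> in \<open>R(I)\<close>, and if \<open>a\<close> dominates \<open>b\<close>, then the deletion \<open>D\<close> of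
  \<open>a\<close> is a cone with apex \<open>b\<close>. Write a chain of \<open>R(I)\<close> as \<open>W\<^sub>a u\<^sub>1 + u\<^sub>0\<close> with \<open>u\<^sub>1\<close> in the link and
  \<open>u\<^sub>0\<close> in \<open>D\<close>; comparing the parts that contain \<open>a\<close> shows that \<open>z \<mapsto> W\<^sub>a z - W\<^sub>b z\<close> is injective on
  homology, and it is surjective because a cycle \<open>v\<close> of \<open>D\<close> is \<open>\<partial>W\<^sub>b v\<close>. Composing these maps along
  the resolution gives \<open>\<phi>\<close>.
\<close>

section \<open>Face monomials\<close>

text \<open>Exponent vectors can be cancelled, so only one term of the convolution
  contributes.\<close>

lemma lookup_monomial_mult_shift: "Poly_Mapping.lookup (monomial k * f) (k + m) = Poly_Mapping.lookup f m"
proof -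
  have "Poly_Mapping.lookup (monomial k * f) (k + m)
    = Sum_any (\<lambda>l. Poly_Mapping.lookup (monomial k) l * Sum_any (\<lambda>q. Poly_Mapping.lookup f q when k + m = l + q))"
    by (simp add: lookup_mult)
  also have "\<dots> = Sum_any (\<lambda>l. Sum_any (\<lambda>q. Poly_Mapping.lookup f q when k + m = l + q) when l = k)"
    by (intro Sum_any.cong) (auto simp: monomial_def lookup_single when_def)
  also have "\<dots> = Sum_any (\<lambda>q. Poly_Mapping.lookup f q when m = q)"
    by simp
  finally show ?thesis by simp
qed

lemma lookup_monomial_mult_eq_0:
  assumes "\<And>m. n \<noteq> k + m"
  shows "Poly_Mapping.lookup (monomial k * f) n = 0"
proof -
  have "n \<notin> Poly_Mapping.keys (monomial k * f)"
    using keys_mult[of "monomial k" f] assms by (auto simp: monomial_def)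
  then show ?thesis by (simp add: in_keys_iff)
qed

lemma monomial_mult: "monomial k * monomial m = monomial (k + m)"
  by (simp add: monomial_def mult_single)

lemma monomial_0: "monomial 0 = 1"
  by (simp add: monomial_def)

lemma monomial_sum: "(\<Prod>x\<in>A. monomial (f x)) = monomial (\<Sum>x\<in>A. f x)"
  by (induction A rule: infinite_finite_induct) (simp_all add: monomial_mult monomial_0)

lemma face_mon_eq_monomial: "face_mon \<sigma> = monomial (face_exp \<sigma>)"
  by (simp add: face_mon_def face_exp_def var_def monomial_sum)

lemma face_mon_insert:
  fixes \<sigma> :: "'x::finite set"
  assumes "x \<notin> \<sigma>"
  shows "face_mon (insert x \<sigma>) = var x * face_mon \<sigma>"
  using assms by (simp add: face_mon_def)

lemma lookup_face_exp: "Poly_Mapping.lookup (face_exp (\<sigma>::'x::finite set)) x = (if x \<in> \<sigma> then 1 else 0)"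
  by (auto simp: face_exp_def lookup_sum lookup_single when_def)

lemma face_exp_eq_iff [simp]:
  "face_exp \<sigma> = face_exp \<tau> \<longleftrightarrow> \<sigma> = (\<tau>::'x::finite set)"
proof
  assume eq: "face_exp \<sigma> = face_exp \<tau>"
  have "x \<in> \<sigma> \<longleftrightarrow> x \<in> \<tau>" for x
    using arg_cong[OF eq, of "\<lambda>e. Poly_Mapping.lookup e x"] by (auto simp: lookup_face_exp split: if_splits)
  then show "\<sigma> = \<tau>" by blast
qed simp

lemma face_exp_remove:
  "x \<in> \<sigma> \<Longrightarrow> face_exp (\<sigma>::'x::finite set) = Poly_Mapping.single x 1 + face_exp (\<sigma> - {x})"
  by (simp add: face_exp_def sum.remove)

text \<open>Divisors of square-free monomials are square-free, so the face coefficients of the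
  product depend only on those of \<open>f\<close>. This is what allows squares to be dropped
  between the factors of a product.\<close>

lemma face_coeff_var_mult:
  "face_coeff (var x * f) \<sigma> = (if x \<in> \<sigma> then face_coeff f (\<sigma> - {x}) else 0)"
  for \<sigma> :: "'x::finite set"
proof (cases "x \<in> \<sigma>")
  case True
  then show ?thesis
    by (simp add: face_coeff_def var_def face_exp_remove[OF True] lookup_monomial_mult_shift)
next
  case False
  have "face_exp \<sigma> \<noteq> Poly_Mapping.single x 1 + m" for m
  proof
    assume "face_exp \<sigma> = Poly_Mapping.single x 1 + m"
    from arg_cong[OF this, of "\<lambda>e. Poly_Mapping.lookup e x"] False show False
      by (simp add: lookup_face_exp lookup_add)
  qed
  then show ?thesis
    using False by (simp add: face_coeff_def var_def lookup_monomial_mult_eq_0)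
qed

lemma face_coeff_add [simp]: "face_coeff (f + g) \<sigma> = face_coeff f \<sigma> + face_coeff g \<sigma>"
  by (simp add: face_coeff_def lookup_add)

lemma face_coeff_diff [simp]: "face_coeff (f - g) \<sigma> = face_coeff f \<sigma> - face_coeff g \<sigma>"
  by (simp add: face_coeff_def lookup_minus)

lemma face_coeff_0 [simp]: "face_coeff 0 \<sigma> = 0"
  by (simp add: face_coeff_def)

lemma face_coeff_sum: "face_coeff (\<Sum>i\<in>A. f i) \<sigma> = (\<Sum>i\<in>A. face_coeff (f i) \<sigma>)"
  by (simp add: face_coeff_def lookup_sum)

lemma lookup_of_int_mult: "Poly_Mapping.lookup (of_int c * f :: 'x mpoly) m = c * Poly_Mapping.lookup f m"
proof (induction c rule: int_induct[where k = 0])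
  case (step1 i)
  then show ?case by (simp add: algebra_simps lookup_add)
next
  case (step2 i)
  then show ?case by (simp add: algebra_simps lookup_minus)
qed simp

lemma face_coeff_of_int_mult [simp]: "face_coeff (of_int c * f) \<sigma> = c * face_coeff f \<sigma>"
  by (simp add: face_coeff_def lookup_of_int_mult)

lemma face_coeff_face_mon [simp]:
  "face_coeff (face_mon \<tau>) \<sigma> = (if \<sigma> = \<tau> then 1 else 0)" for \<sigma> \<tau> :: "'x::finite set"
  by (auto simp: face_coeff_def face_mon_eq_monomial monomial_def lookup_single when_def)


section \<open>Chains and linear extensions\<close>

lemma chainsI_face_mon [intro]: "\<sigma> \<in> \<Delta> \<Longrightarrow> face_mon \<sigma> \<in> chains \<Delta>"
  by (auto simp: chains_def face_mon_eq_monomial monomial_def)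

lemma chains_0 [simp]: "0 \<in> chains \<Delta>"
  by (simp add: chains_def)

lemma chains_add: "u \<in> chains \<Delta> \<Longrightarrow> v \<in> chains \<Delta> \<Longrightarrow> u + v \<in> chains \<Delta>"
  unfolding chains_def using Poly_Mapping.keys_add[of u v] by blast

lemma chains_uminus: "u \<in> chains \<Delta> \<Longrightarrow> - u \<in> chains \<Delta>"
  unfolding chains_def by (auto simp: in_keys_iff)

lemma chains_diff: "u \<in> chains \<Delta> \<Longrightarrow> v \<in> chains \<Delta> \<Longrightarrow> u - v \<in> chains \<Delta>"
  using chains_add[of u \<Delta> "- v"] chains_uminus[of v \<Delta>] by simp

lemma chains_of_int_mult: "u \<in> chains \<Delta> \<Longrightarrow> of_int c * u \<in> chains \<Delta>"
  unfolding chains_def by (auto simp: in_keys_iff lookup_of_int_mult)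

lemma chains_sum: "(\<And>i. i \<in> A \<Longrightarrow> f i \<in> chains \<Delta>) \<Longrightarrow> (\<Sum>i\<in>A. f i) \<in> chains \<Delta>"
  by (induction A rule: infinite_finite_induct) (auto intro: chains_add)

lemma chains_mono: "\<Delta> \<subseteq> \<Gamma> \<Longrightarrow> chains \<Delta> \<subseteq> chains \<Gamma>"
  unfolding chains_def by blast

lemma face_coeff_eq_0: "z \<in> chains \<Delta> \<Longrightarrow> \<sigma> \<notin> \<Delta> \<Longrightarrow> face_coeff z \<sigma> = 0"
  for \<sigma> :: "'x::finite set"
  unfolding face_coeff_def not_in_keys_iff_lookup_eq_zero[symmetric] by (auto simp: chains_def)

text \<open>A chain is supported on exponents of faces, so its face coefficients determine it; a
  polynomial with squares is not determined in this way.\<close>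

lemma chains_eqI:
  fixes u v :: "'x::finite mpoly"
  assumes "u \<in> chains \<Delta>" "v \<in> chains \<Gamma>" "\<And>\<sigma>. face_coeff u \<sigma> = face_coeff v \<sigma>"
  shows "u = v"
proof (rule poly_mapping_eqI)
  fix m
  show "Poly_Mapping.lookup u m = Poly_Mapping.lookup v m"
  proof (cases "m \<in> range face_exp")
    case True
    then show ?thesis using assms(3) by (auto simp: face_coeff_def)
  next
    case False
    with assms have "m \<notin> Poly_Mapping.keys u" "m \<notin> Poly_Mapping.keys v"
      by (auto simp: chains_def)
    then show ?thesis by (simp add: in_keys_iff)
  qed
qed

text \<open>Reads only the face coefficients of its argument, so it is total on polynomials and
  ignores terms with squares. Boundary, square dropping and exterior multiplication are all of this
  form, which reduces identities between them to single faces.\<close>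

definition lin_ext :: "('x::finite set \<Rightarrow> 'x mpoly) \<Rightarrow> 'x mpoly \<Rightarrow> 'x mpoly" where
  "lin_ext g z = (\<Sum>\<sigma>\<in>UNIV. of_int (face_coeff z \<sigma>) * g \<sigma>)"

lemma lin_ext_add: "lin_ext g (u + v) = lin_ext g u + lin_ext g v"
  by (simp add: lin_ext_def algebra_simps sum.distrib)

lemma lin_ext_diff: "lin_ext g (u - v) = lin_ext g u - lin_ext g v"
  by (simp add: lin_ext_def algebra_simps sum_subtractf)

lemma lin_ext_0 [simp]: "lin_ext g 0 = 0"
  by (simp add: lin_ext_def)

lemma lin_ext_uminus: "lin_ext g (- u) = - lin_ext g u"
  using lin_ext_diff[of g 0 u] by simp

lemma lin_ext_of_int_mult: "lin_ext g (of_int c * u) = of_int c * lin_ext g u"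
  by (simp add: lin_ext_def sum_distrib_left mult.assoc)

lemma lin_ext_sum: "lin_ext g (\<Sum>i\<in>A. f i) = (\<Sum>i\<in>A. lin_ext g (f i))"
  by (induction A rule: infinite_finite_induct) (auto simp: lin_ext_add)

lemma lin_ext_face_mon [simp]: "lin_ext g (face_mon \<sigma>) = g \<sigma>"
proof -
  have "lin_ext g (face_mon \<sigma>) = (\<Sum>\<tau>\<in>UNIV. if \<tau> = \<sigma> then g \<tau> else 0)"
    unfolding lin_ext_def by (rule sum.cong) auto
  then show ?thesis by simp
qed

lemma lin_ext_compose: "lin_ext g (lin_ext h z) = lin_ext (\<lambda>\<sigma>. lin_ext g (h \<sigma>)) z"
  unfolding lin_ext_def[of h] lin_ext_def[of "\<lambda>\<sigma>. lin_ext g (h \<sigma>)"]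
  by (simp only: lin_ext_sum lin_ext_of_int_mult)

lemma lin_ext_plus_fun: "lin_ext g z + lin_ext h z = lin_ext (\<lambda>\<sigma>. g \<sigma> + h \<sigma>) z"
  by (simp add: lin_ext_def algebra_simps sum.distrib)

lemma lin_ext_minus_fun: "lin_ext g z - lin_ext h z = lin_ext (\<lambda>\<sigma>. g \<sigma> - h \<sigma>) z"
  by (simp add: lin_ext_def algebra_simps sum_subtractf)

lemma lin_ext_cong:
  assumes "z \<in> chains \<Delta>" "\<And>\<sigma>. \<sigma> \<in> \<Delta> \<Longrightarrow> g \<sigma> = h \<sigma>"
  shows "lin_ext g z = lin_ext h z"
  unfolding lin_ext_def
proof (rule sum.cong)
  fix \<sigma>
  show "of_int (face_coeff z \<sigma>) * g \<sigma> = of_int (face_coeff z \<sigma>) * h \<sigma>"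
    using assms face_coeff_eq_0[OF assms(1), of \<sigma>] by (cases "\<sigma> \<in> \<Delta>") auto
qed simp

lemma lin_ext_in_chains:
  assumes "z \<in> chains \<Delta>" "\<And>\<sigma>. \<sigma> \<in> \<Delta> \<Longrightarrow> g \<sigma> \<in> chains \<Gamma>"
  shows "lin_ext g z \<in> chains \<Gamma>"
  unfolding lin_ext_def
proof (rule chains_sum)
  fix \<sigma>
  show "of_int (face_coeff z \<sigma>) * g \<sigma> \<in> chains \<Gamma>"
    using assms face_coeff_eq_0[OF assms(1), of \<sigma>] by (cases "\<sigma> \<in> \<Delta>") (auto intro: chains_of_int_mult)
qed

lemma lin_ext_id:
  assumes "z \<in> chains \<Delta>"
  shows "lin_ext face_mon z = z"
proof (rule chains_eqI[OF _ assms])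
  show "lin_ext face_mon z \<in> chains UNIV"
    using assms chains_mono[of \<Delta> UNIV] by (intro lin_ext_in_chains[of _ UNIV]) auto
  show "face_coeff (lin_ext face_mon z) \<sigma> = face_coeff z \<sigma>" for \<sigma>
    by (simp add: lin_ext_def face_coeff_sum if_distrib cong: if_cong)
qed

lemma drop_squares_eq_lin_ext: "drop_squares = lin_ext face_mon"
  by (simp add: fun_eq_iff drop_squares_def lin_ext_def)

lemma boundary_eq_lin_ext: "boundary ord = lin_ext (face_boundary ord)"
  by (simp add: fun_eq_iff boundary_def lin_ext_def)

lemma face_coeff_drop_squares [simp]: "face_coeff (drop_squares f) \<sigma> = face_coeff f \<sigma>"
  by (simp add: drop_squares_def face_coeff_sum if_distrib cong: if_cong)

lemma drop_squares_cong:
  "(\<And>\<sigma>. face_coeff f \<sigma> = face_coeff g \<sigma>) \<Longrightarrow> drop_squares f = drop_squares g"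
  by (simp add: drop_squares_def)

lemma drop_squares_in_chains: "drop_squares f \<in> chains UNIV"
  unfolding drop_squares_def by (auto intro!: chains_sum chains_of_int_mult)

section \<open>Square-free multiplication by variables\<close>

definition mult_face :: "'x \<Rightarrow> 'x set \<Rightarrow> 'x mpoly" where
  "mult_face a \<sigma> = (if a \<in> \<sigma> then 0 else face_mon (insert a \<sigma>))"

lemma drop_squares_var_mult: "drop_squares (var a * z) = lin_ext (mult_face a) z"
proof (rule chains_eqI[OF drop_squares_in_chains])
  \<comment> \<open>\<open>lin_ext\<close> cannot distinguish \<open>z\<close> from its square-free
    part, and the latter is a chain.\<close>
  let ?z = "drop_squares z"
  have "lin_ext (mult_face a) ?z \<in> chains UNIV"
    by (intro lin_ext_in_chains[OF drop_squares_in_chains]) (auto simp: mult_face_def)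
  then show "lin_ext (mult_face a) z \<in> chains UNIV"
    by (simp add: lin_ext_def)
next
  fix \<sigma>
  have "face_coeff (lin_ext (mult_face a) z) \<sigma>
    = (\<Sum>\<tau>\<in>UNIV. if a \<in> \<sigma> \<and> \<tau> = \<sigma> - {a} then face_coeff z \<tau> else 0)"
    unfolding lin_ext_def face_coeff_sum by (rule sum.cong) (auto simp: mult_face_def)
  then show "face_coeff (drop_squares (var a * z)) \<sigma> = face_coeff (lin_ext (mult_face a) z) \<sigma>"
    by (simp add: face_coeff_var_mult)
qed

lemma drop_squares_diff: "drop_squares (f - g) = drop_squares f - drop_squares g"
  by (simp add: drop_squares_eq_lin_ext lin_ext_diff)

lemma cross_mult_Nil: "z \<in> chains \<Delta> \<Longrightarrow> cross_mult [] [] z = z"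
  by (simp add: cross_mult_def drop_squares_eq_lin_ext lin_ext_id)

text \<open>By \<open>face_coeff_var_mult\<close>, squares may be discarded before the last factor
  is applied. The resulting recursion has the same shape as the composition of maps along the
  resolution.\<close>

lemma cross_mult_Cons:
  assumes "length bs = length as"
  shows "cross_mult (a # as) (b # bs) z
    = lin_ext (\<lambda>\<sigma>. mult_face a \<sigma> - mult_face b \<sigma>) (cross_mult as bs z)"
proof -
  define p where "p = (\<Prod>i<length as. var (as ! i) - var (bs ! i)) * z"
  have "cross_mult (a # as) (b # bs) z = drop_squares ((var a - var b) * p)"
    unfolding cross_mult_def p_def by (simp add: prod.lessThan_Suc_shift mult.assoc del: prod.lessThan_Suc)
  also have "\<dots> = drop_squares ((var a - var b) * drop_squares p)"
    by (rule drop_squares_cong) (simp add: left_diff_distrib face_coeff_var_mult)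
  also have "\<dots> = lin_ext (\<lambda>\<sigma>. mult_face a \<sigma> - mult_face b \<sigma>) (drop_squares p)"
    by (simp add: left_diff_distrib drop_squares_diff drop_squares_var_mult lin_ext_minus_fun)
  finally show ?thesis by (simp add: p_def cross_mult_def)
qed


section \<open>Exterior multiplication by a vertex\<close>

text \<open>The sign of the term of the boundary in which \<open>a\<close> is removed; equally, the
  sign of moving \<open>a\<close> from the front of an ordered face to its place.\<close>

definition pos_sign :: "'x rel \<Rightarrow> 'x \<Rightarrow> 'x set \<Rightarrow> int" where
  "pos_sign ord a \<sigma> = (- 1) ^ card {y \<in> \<sigma>. (y, a) \<in> ord \<and> y \<noteq> a}"

definition wedge_face :: "'x rel \<Rightarrow> 'x \<Rightarrow> 'x set \<Rightarrow> 'x mpoly" where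
  "wedge_face ord a \<sigma> = of_int (pos_sign ord a \<sigma>) * mult_face a \<sigma>"

definition wedge :: "'x::finite rel \<Rightarrow> 'x \<Rightarrow> 'x mpoly \<Rightarrow> 'x mpoly" where
  "wedge ord a = lin_ext (wedge_face ord a)"

lemma face_boundary_eq:
  "face_boundary ord \<sigma> = (\<Sum>x\<in>\<sigma>. of_int (pos_sign ord x \<sigma>) * face_mon (\<sigma> - {x}))"
  by (simp add: face_boundary_def pos_sign_def)

lemma pos_sign_square [simp]: "pos_sign ord a \<sigma> * pos_sign ord a \<sigma> = 1"
  by (simp add: pos_sign_def flip: power_mult_distrib)

lemma of_int_pos_sign_square [simp]:
  "of_int (pos_sign ord a \<sigma>) * (of_int (pos_sign ord a \<sigma>) * z) = (z :: 'a::ring_1)"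
  by (metis mult.assoc mult_1 of_int_1 of_int_mult pos_sign_square)

lemma pos_sign_cases: "pos_sign ord a \<sigma> = 1 \<or> pos_sign ord a \<sigma> = - 1"
  by (simp add: pos_sign_def minus_one_power_iff)

lemma pos_sign_remove_self [simp]: "pos_sign ord a (\<sigma> - {a}) = pos_sign ord a \<sigma>"
  unfolding pos_sign_def by (rule arg_cong[where f = "\<lambda>A. (- 1) ^ card A"]) auto

lemma pos_sign_insert_self [simp]: "pos_sign ord a (insert a \<sigma>) = pos_sign ord a \<sigma>"
  unfolding pos_sign_def by (rule arg_cong[where f = "\<lambda>A. (- 1) ^ card A"]) auto

lemma pos_sign_insert:
  fixes \<sigma> :: "'x::finite set"
  assumes "x \<notin> \<sigma>" "x \<noteq> a"
  shows "pos_sign ord a (insert x \<sigma>) = (if (x, a) \<in> ord then - pos_sign ord a \<sigma> else pos_sign ord a \<sigma>)"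
proof -
  have "{y \<in> insert x \<sigma>. (y, a) \<in> ord \<and> y \<noteq> a}
    = (if (x, a) \<in> ord then insert x {y \<in> \<sigma>. (y, a) \<in> ord \<and> y \<noteq> a} else {y \<in> \<sigma>. (y, a) \<in> ord \<and> y \<noteq> a})"
    using assms by auto
  then show ?thesis
    using assms(1) by (simp add: pos_sign_def)
qed

text \<open>Exactly one of \<open>a\<close> and \<open>x\<close> precedes the other. So exactly one
  of two sign changes happens: that of \<open>a\<close> when \<open>x\<close> is removed, or that of
  \<open>x\<close> when \<open>a\<close> is inserted.\<close>

lemma pos_sign_swap:
  fixes \<sigma> :: "'x::finite set"
  assumes "linear_order ord" "x \<in> \<sigma>" "a \<notin> \<sigma>"
  shows "pos_sign ord a \<sigma> * pos_sign ord x (insert a \<sigma>)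
    = - (pos_sign ord x \<sigma> * pos_sign ord a (\<sigma> - {x}))"
proof -
  have "x \<noteq> a" using assms by auto
  have eq: "pos_sign ord a \<sigma>
      = (if (x, a) \<in> ord then - pos_sign ord a (\<sigma> - {x}) else pos_sign ord a (\<sigma> - {x}))"
    using pos_sign_insert[of x "\<sigma> - {x}" a ord] assms(2) \<open>x \<noteq> a\<close> by (simp add: insert_absorb)
  have "(x, a) \<in> ord \<longleftrightarrow> (a, x) \<notin> ord"
    using assms(1) \<open>x \<noteq> a\<close>
    by (auto simp: linear_order_on_def partial_order_on_def total_on_def antisym_def)
  then show ?thesis
    unfolding eq using \<open>x \<noteq> a\<close> assms(3) by (simp add: pos_sign_insert)
qed

lemma wedge_face_in: "a \<in> \<sigma> \<Longrightarrow> wedge_face ord a \<sigma> = 0"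
  by (simp add: wedge_face_def mult_face_def)

lemma wedge_face_notin:
  "a \<notin> \<sigma> \<Longrightarrow> wedge_face ord a \<sigma> = of_int (pos_sign ord a \<sigma>) * face_mon (insert a \<sigma>)"
  by (simp add: wedge_face_def mult_face_def)

lemma boundary_wedge_face:
  fixes \<sigma> :: "'x::finite set"
  assumes "linear_order ord"
  shows "boundary ord (wedge_face ord a \<sigma>) + wedge ord a (face_boundary ord \<sigma>) = face_mon \<sigma>"
proof (cases "a \<in> \<sigma>")
  case True
  \<comment> \<open>Terms of the boundary that still contain \<open>a\<close> are killed, so only
    the one with \<open>a\<close> removed survives, and its sign occurs twice.\<close>
  have "wedge ord a (face_boundary ord \<sigma>)
      = (\<Sum>x\<in>\<sigma>. of_int (pos_sign ord x \<sigma>) * wedge_face ord a (\<sigma> - {x}))"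
    by (simp add: wedge_def face_boundary_eq lin_ext_sum lin_ext_of_int_mult)
  also have "\<dots> = (\<Sum>x\<in>\<sigma>. if x = a then face_mon \<sigma> else 0)"
    using True by (intro sum.cong) (auto simp: wedge_face_in wedge_face_notin insert_absorb)
  finally show ?thesis
    using True by (simp add: wedge_face_in boundary_eq_lin_ext)
next
  case False
  \<comment> \<open>Removing \<open>a\<close> again gives back \<sigma>; by
    \<open>pos_sign_swap\<close> all other terms cancel against those of the second summand.\<close>
  have "boundary ord (wedge_face ord a \<sigma>)
      = of_int (pos_sign ord a \<sigma>) * face_boundary ord (insert a \<sigma>)"
    using False by (simp add: wedge_face_notin boundary_eq_lin_ext lin_ext_of_int_mult)
  also have "\<dots> = face_mon \<sigma> + of_int (pos_sign ord a \<sigma>)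
       * (\<Sum>x\<in>\<sigma>. of_int (pos_sign ord x (insert a \<sigma>)) * face_mon (insert a \<sigma> - {x}))"
    using False by (simp add: face_boundary_eq distrib_left)
  also have "\<dots> = face_mon \<sigma>
       + (\<Sum>x\<in>\<sigma>. of_int (pos_sign ord a \<sigma> * pos_sign ord x (insert a \<sigma>)) * face_mon (insert a \<sigma> - {x}))"
    by (simp add: sum_distrib_left mult.assoc)
  also have "(\<Sum>x\<in>\<sigma>. of_int (pos_sign ord a \<sigma> * pos_sign ord x (insert a \<sigma>)) * face_mon (insert a \<sigma> - {x}))
     = - (\<Sum>x\<in>\<sigma>. of_int (pos_sign ord x \<sigma>) * wedge_face ord a (\<sigma> - {x}))"
    unfolding sum_negf[symmetric]
  proof (rule sum.cong)
    fix x assume "x \<in> \<sigma>"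
    then have "insert a \<sigma> - {x} = insert a (\<sigma> - {x})" "a \<notin> \<sigma> - {x}" using False by auto
    then show "of_int (pos_sign ord a \<sigma> * pos_sign ord x (insert a \<sigma>)) * face_mon (insert a \<sigma> - {x})
       = - (of_int (pos_sign ord x \<sigma>) * wedge_face ord a (\<sigma> - {x}))"
      unfolding pos_sign_swap[OF assms \<open>x \<in> \<sigma>\<close> False] by (simp add: wedge_face_notin)
  qed simp
  also have "(\<Sum>x\<in>\<sigma>. of_int (pos_sign ord x \<sigma>) * wedge_face ord a (\<sigma> - {x})) = wedge ord a (face_boundary ord \<sigma>)"
    by (simp add: wedge_def face_boundary_eq lin_ext_sum lin_ext_of_int_mult)
  finally show ?thesis by simp
qed

text \<open>For a polynomial that is not a chain, the first term on the right would have to be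
  replaced by the square-free part of \<open>z\<close>.\<close>

lemma boundary_wedge:
  assumes "linear_order ord" "z \<in> chains \<Delta>"
  shows "boundary ord (wedge ord a z) = z - wedge ord a (boundary ord z)"
proof -
  have "boundary ord (wedge ord a z) + wedge ord a (boundary ord z)
    = lin_ext (\<lambda>\<sigma>. boundary ord (wedge_face ord a \<sigma>) + wedge ord a (face_boundary ord \<sigma>)) z"
    by (simp add: boundary_eq_lin_ext wedge_def lin_ext_compose lin_ext_plus_fun)
  also have "\<dots> = z"
    using assms by (simp add: boundary_wedge_face lin_ext_id)
  finally show ?thesis by (simp add: algebra_simps)
qed

lemma wedge_0 [simp]: "wedge ord a 0 = 0"
  by (simp add: wedge_def)

lemma wedge_add: "wedge ord a (u + v) = wedge ord a u + wedge ord a v"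
  by (simp add: wedge_def lin_ext_add)

lemma boundary_0 [simp]: "boundary ord 0 = 0"
  by (simp add: boundary_eq_lin_ext)

lemma boundary_add: "boundary ord (u + v) = boundary ord u + boundary ord v"
  by (simp add: boundary_eq_lin_ext lin_ext_add)

lemma boundary_diff: "boundary ord (u - v) = boundary ord u - boundary ord v"
  by (simp add: boundary_eq_lin_ext lin_ext_diff)

lemma boundary_uminus: "boundary ord (- u) = - boundary ord u"
  by (simp add: boundary_eq_lin_ext lin_ext_uminus)

lemma face_boundary_in_chains:
  assumes "\<And>x. x \<in> \<sigma> \<Longrightarrow> \<sigma> - {x} \<in> \<Delta>"
  shows "face_boundary ord \<sigma> \<in> chains \<Delta>"
  unfolding face_boundary_eq using assms by (intro chains_sum chains_of_int_mult) auto

lemma boundary_in_chains: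
  assumes "z \<in> chains \<Delta>" "\<And>\<sigma> x. \<sigma> \<in> \<Delta> \<Longrightarrow> x \<in> \<sigma> \<Longrightarrow> \<sigma> - {x} \<in> \<Gamma>"
  shows "boundary ord z \<in> chains \<Gamma>"
  unfolding boundary_eq_lin_ext
  using assms by (intro lin_ext_in_chains[OF assms(1)] face_boundary_in_chains)

text \<open>
  From \<open>\<partial>W = 1 - W\<partial>\<close> one gets \<open>\<partial>\<partial>W = W\<partial>\<partial>\<close>, where \<open>W\<close> is exterior multiplication by a vertex,
  and every nonempty face is in the image of some \<open>W\<close>.
\<close>

lemma boundary_face_boundary:
  fixes \<sigma> :: "'x::finite set"
  assumes ord: "linear_order ord"
  shows "boundary ord (face_boundary ord \<sigma>) = 0"
proof (induction \<sigma> rule: finite_induct[OF finite])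
  case 1
  then show ?case by (simp add: face_boundary_eq)
next
  case (2 a \<sigma>)
  let ?d = "boundary ord" and ?W = "wedge ord a"
  have in_UNIV: "face_boundary ord \<sigma> \<in> chains UNIV"
    by (intro face_boundary_in_chains) simp
  have "?d (?d (wedge_face ord a \<sigma>)) = ?d (face_mon \<sigma> - ?W (face_boundary ord \<sigma>))"
    by (simp flip: boundary_wedge_face[OF ord, of a \<sigma>])
  also have "\<dots> = face_boundary ord \<sigma> - (face_boundary ord \<sigma> - ?W (?d (face_boundary ord \<sigma>)))"
    unfolding boundary_diff boundary_wedge[OF ord in_UNIV] by (simp add: boundary_eq_lin_ext)
  also have "\<dots> = 0"
    by (simp add: 2)
  finally have "of_int (pos_sign ord a \<sigma>) * ?d (face_boundary ord (insert a \<sigma>)) = 0"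
    using 2(2) by (simp add: wedge_face_notin boundary_eq_lin_ext lin_ext_of_int_mult)
  \<comment> \<open>A sign is its own inverse, so multiplying by it once more removes it.\<close>
  then have "of_int (pos_sign ord a \<sigma>) * (of_int (pos_sign ord a \<sigma>) * ?d (face_boundary ord (insert a \<sigma>))) = 0"
    by simp
  then show ?case by (simp only: of_int_pos_sign_square)
qed

lemma boundary_boundary:
  assumes "linear_order ord"
  shows "boundary ord (boundary ord z) = 0"
  using assms boundary_face_boundary[of ord]
  by (simp add: boundary_eq_lin_ext lin_ext_compose) (simp add: lin_ext_def)


section \<open>Links\<close>

definition down_closed :: "'x set set \<Rightarrow> bool" where
  "down_closed \<Delta> \<longleftrightarrow> (\<forall>\<sigma>\<in>\<Delta>. \<forall>\<tau>\<subseteq>\<sigma>. \<tau> \<in> \<Delta>)"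

definition link :: "'x set set \<Rightarrow> 'x \<Rightarrow> 'x set set" where
  "link \<Delta> a = {\<sigma>. a \<notin> \<sigma> \<and> insert a \<sigma> \<in> \<Delta>}"

lemma down_closed_link: "down_closed \<Delta> \<Longrightarrow> down_closed (link \<Delta> a)"
  unfolding down_closed_def link_def
  by (metis (mono_tags, lifting) insert_mono mem_Collect_eq subsetD)

lemma wedge_in_chains:
  assumes "z \<in> chains \<Delta>" "\<And>\<sigma>. \<sigma> \<in> \<Delta> \<Longrightarrow> a \<notin> \<sigma> \<Longrightarrow> insert a \<sigma> \<in> \<Gamma>"
  shows "wedge ord a z \<in> chains \<Gamma>"
  unfolding wedge_def
  using assms(2) by (intro lin_ext_in_chains[OF assms(1)])
    (auto simp: wedge_face_def mult_face_def intro!: chains_of_int_mult)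

lemma face_coeff_wedge:
  fixes \<sigma> :: "'x::finite set"
  assumes "a \<notin> \<sigma>"
  shows "face_coeff (wedge ord a z) (insert a \<sigma>) = pos_sign ord a \<sigma> * face_coeff z \<sigma>"
proof -
  have "face_coeff (wedge ord a z) (insert a \<sigma>)
    = (\<Sum>\<tau>\<in>UNIV. if \<tau> = \<sigma> then pos_sign ord a \<sigma> * face_coeff z \<sigma> else 0)"
    unfolding wedge_def lin_ext_def face_coeff_sum
    using assms by (intro sum.cong) (auto simp: wedge_face_def mult_face_def dest: insert_ident)
  then show ?thesis by simp
qed

text \<open>Every face in the support of \<open>wedge ord a x\<close> contains \<open>a\<close>, and
  none in that of \<open>y\<close> does, so both sides vanish; and \<open>wedge\<close> by
  \<open>a\<close> only changes signs and adds \<open>a\<close>, hence loses nothing on chains that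
  avoid \<open>a\<close>.\<close>

lemma wedge_eq_imp_0:
  assumes "x \<in> chains {\<sigma>. a \<notin> \<sigma>}" "y \<in> chains {\<sigma>. a \<notin> \<sigma>}" "wedge ord a x = y"
  shows "x = 0"
proof (rule chains_eqI[OF assms(1) chains_0])
  fix \<sigma>
  show "face_coeff x \<sigma> = face_coeff 0 \<sigma>"
  proof (cases "a \<in> \<sigma>")
    case True
    then show ?thesis using face_coeff_eq_0[OF assms(1)] by simp
  next
    case False
    have "pos_sign ord a \<sigma> * face_coeff x \<sigma> = face_coeff y (insert a \<sigma>)"
      using face_coeff_wedge[OF False, of ord x] assms(3) by simp
    also have "\<dots> = 0"
      using face_coeff_eq_0[OF assms(2)] by simp
    finally show ?thesis
      using pos_sign_cases[of ord a \<sigma>] by auto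
  qed
qed

lemma chains_decompose:
  assumes "u \<in> chains \<Delta>"
  obtains u1 u0 where "u1 \<in> chains (link \<Delta> a)" "u0 \<in> chains {\<sigma> \<in> \<Delta>. a \<notin> \<sigma>}"
    "u = wedge ord a u1 + u0"
proof
  \<comment> \<open>\<open>?g1\<close> strips \<open>a\<close> off a face together with the sign
    that \<open>wedge\<close> will put back; \<open>?g0\<close> keeps the faces without
    \<open>a\<close>.\<close>
  let ?g1 = "\<lambda>\<sigma>. if a \<in> \<sigma> then of_int (pos_sign ord a \<sigma>) * face_mon (\<sigma> - {a}) else 0"
  let ?g0 = "\<lambda>\<sigma>. if a \<in> \<sigma> then 0 else face_mon \<sigma>"
  show "lin_ext ?g1 u \<in> chains (link \<Delta> a)"
    by (intro lin_ext_in_chains[OF assms]) (auto simp: link_def insert_absorb intro!: chains_of_int_mult)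
  show "lin_ext ?g0 u \<in> chains {\<sigma> \<in> \<Delta>. a \<notin> \<sigma>}"
    by (intro lin_ext_in_chains[OF assms]) auto
  have "wedge ord a (lin_ext ?g1 u) + lin_ext ?g0 u
      = lin_ext (\<lambda>\<sigma>. lin_ext (wedge_face ord a) (?g1 \<sigma>) + ?g0 \<sigma>) u"
    by (simp only: wedge_def lin_ext_compose lin_ext_plus_fun)
  also have "\<dots> = lin_ext face_mon u"
    by (rule arg_cong[where f = "\<lambda>g. lin_ext g u"])
       (auto simp: fun_eq_iff lin_ext_of_int_mult wedge_face_notin insert_absorb)
  finally show "u = wedge ord a (lin_ext ?g1 u) + lin_ext ?g0 u"
    using assms by (simp add: lin_ext_id)
qed


section \<open>Homology equivalences\<close>

lemma boundary_in_chains_dim: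
  assumes "down_closed \<Delta>" "z \<in> chains_dim \<Delta> (d + 1)"
  shows "boundary ord z \<in> chains_dim \<Delta> d"
  using assms(2) unfolding chains_dim_def
proof (rule boundary_in_chains)
  fix \<sigma> x assume "\<sigma> \<in> {\<sigma> \<in> \<Delta>. int (card \<sigma>) = d + 1 + 1}" "x \<in> \<sigma>"
  \<comment> \<open>Makes the subtraction of natural numbers in the cardinality of
    \<open>\<sigma> - {x}\<close> exact.\<close>
  moreover from this have "card \<sigma> > 0"
    by (auto simp: card_gt_0_iff)
  ultimately show "\<sigma> - {x} \<in> {\<sigma> \<in> \<Delta>. int (card \<sigma>) = d + 1}"
    using assms(1) unfolding down_closed_def by (auto simp: of_nat_diff)
qed

lemma wedge_in_chains_dim:
  fixes \<Delta> :: "'x::finite set set"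
  assumes "z \<in> chains_dim \<Delta> d" "\<And>\<sigma>. \<sigma> \<in> \<Delta> \<Longrightarrow> a \<notin> \<sigma> \<Longrightarrow> insert a \<sigma> \<in> \<Gamma>"
  shows "wedge ord a z \<in> chains_dim \<Gamma> (d + 1)"
  using assms unfolding chains_dim_def by (intro wedge_in_chains[OF assms(1)[unfolded chains_dim_def]]) auto

lemma chains_dim_subset_chains: "chains_dim \<Delta> d \<subseteq> chains \<Delta>"
  unfolding chains_dim_def by (rule chains_mono) auto

lemma chains_dim_mono: "\<Delta> \<subseteq> \<Gamma> \<Longrightarrow> chains_dim \<Delta> d \<subseteq> chains_dim \<Gamma> d"
  unfolding chains_dim_def by (rule chains_mono) auto

lemma chains_dim_0 [simp]: "0 \<in> chains_dim \<Delta> d"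
  by (simp add: chains_dim_def)

lemma chains_dim_add: "u \<in> chains_dim \<Delta> d \<Longrightarrow> v \<in> chains_dim \<Delta> d \<Longrightarrow> u + v \<in> chains_dim \<Delta> d"
  by (simp add: chains_dim_def chains_add)

lemma chains_dim_diff: "u \<in> chains_dim \<Delta> d \<Longrightarrow> v \<in> chains_dim \<Delta> d \<Longrightarrow> u - v \<in> chains_dim \<Delta> d"
  by (simp add: chains_dim_def chains_diff)

lemma chains_dim_uminus: "u \<in> chains_dim \<Delta> d \<Longrightarrow> - u \<in> chains_dim \<Delta> d"
  by (simp add: chains_dim_def chains_uminus)

lemma cycles_dim_subset_cycles: "cycles_dim ord \<Delta> d \<subseteq> cycles ord \<Delta>"
  using chains_dim_subset_chains by (auto simp: cycles_dim_def cycles_def)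

lemma cycles_dim_0 [simp]: "0 \<in> cycles_dim ord \<Delta> d"
  by (simp add: cycles_dim_def)

lemma cycles_dim_add:
  "u \<in> cycles_dim ord \<Delta> d \<Longrightarrow> v \<in> cycles_dim ord \<Delta> d \<Longrightarrow> u + v \<in> cycles_dim ord \<Delta> d"
  by (simp add: cycles_dim_def chains_dim_add boundary_add)

lemma cycles_dim_diff:
  "u \<in> cycles_dim ord \<Delta> d \<Longrightarrow> v \<in> cycles_dim ord \<Delta> d \<Longrightarrow> u - v \<in> cycles_dim ord \<Delta> d"
  by (simp add: cycles_dim_def chains_dim_diff boundary_diff)

lemma cycles_dim_uminus: "u \<in> cycles_dim ord \<Delta> d \<Longrightarrow> - u \<in> cycles_dim ord \<Delta> d"
  by (simp add: cycles_dim_def chains_dim_uminus boundary_uminus)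

lemma cycles_add: "u \<in> cycles ord \<Delta> \<Longrightarrow> v \<in> cycles ord \<Delta> \<Longrightarrow> u + v \<in> cycles ord \<Delta>"
  by (simp add: cycles_def chains_add boundary_add)

lemma boundaries_dim_0 [simp]: "0 \<in> boundaries_dim ord \<Delta> d"
  unfolding boundaries_dim_def by (metis boundary_0 chains_dim_0 imageI)

lemma boundaries_dim_add:
  "u \<in> boundaries_dim ord \<Delta> d \<Longrightarrow> v \<in> boundaries_dim ord \<Delta> d \<Longrightarrow> u + v \<in> boundaries_dim ord \<Delta> d"
  unfolding boundaries_dim_def by (auto simp flip: boundary_add intro!: imageI chains_dim_add)

lemma boundaries_dim_uminus: "u \<in> boundaries_dim ord \<Delta> d \<Longrightarrow> - u \<in> boundaries_dim ord \<Delta> d"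
  unfolding boundaries_dim_def by (auto simp flip: boundary_uminus intro!: imageI chains_dim_uminus)

lemma boundaries_dim_diff:
  "u \<in> boundaries_dim ord \<Delta> d \<Longrightarrow> v \<in> boundaries_dim ord \<Delta> d \<Longrightarrow> u - v \<in> boundaries_dim ord \<Delta> d"
  unfolding boundaries_dim_def by (auto simp flip: boundary_diff intro!: imageI chains_dim_diff)

lemma boundaries_dim_subset_cycles_dim:
  assumes "linear_order ord" "down_closed \<Delta>"
  shows "boundaries_dim ord \<Delta> d \<subseteq> cycles_dim ord \<Delta> d"
  using assms boundary_in_chains_dim
  by (auto simp: boundaries_dim_def cycles_dim_def boundary_boundary)

text \<open>Elementwise form of a quasi-isomorphism, without quotient groups: the fourth clause
  makes the induced map well defined and injective, the last makes it surjective. In this form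
  composition is easy.\<close>

definition homology_equiv ::
    "'x::finite rel \<Rightarrow> nat \<Rightarrow> 'x set set \<Rightarrow> 'x set set \<Rightarrow> ('x mpoly \<Rightarrow> 'x mpoly) \<Rightarrow> bool" where
  "homology_equiv ord r \<Delta> \<Gamma> \<phi> \<longleftrightarrow>
     (\<forall>u\<in>cycles ord \<Delta>. \<forall>v\<in>cycles ord \<Delta>. \<phi> (u + v) = \<phi> u + \<phi> v) \<and>
     \<phi> ` cycles ord \<Delta> \<subseteq> cycles ord \<Gamma> \<and>
     (\<forall>d. \<phi> ` cycles_dim ord \<Delta> d \<subseteq> cycles_dim ord \<Gamma> (d + int r)) \<and>
     (\<forall>d. \<forall>z\<in>cycles_dim ord \<Delta> d.
        \<phi> z \<in> boundaries_dim ord \<Gamma> (d + int r) \<longleftrightarrow> z \<in> boundaries_dim ord \<Delta> d) \<and>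
     (\<forall>d. \<forall>w\<in>cycles_dim ord \<Gamma> (d + int r). \<exists>z\<in>cycles_dim ord \<Delta> d.
        w - \<phi> z \<in> boundaries_dim ord \<Gamma> (d + int r))"

lemma homology_equivD:
  assumes "homology_equiv ord r \<Delta> \<Gamma> \<phi>"
  shows "\<And>u v. u \<in> cycles ord \<Delta> \<Longrightarrow> v \<in> cycles ord \<Delta> \<Longrightarrow> \<phi> (u + v) = \<phi> u + \<phi> v"
    and "\<And>u. u \<in> cycles ord \<Delta> \<Longrightarrow> \<phi> u \<in> cycles ord \<Gamma>"
    and "\<And>d u. u \<in> cycles_dim ord \<Delta> d \<Longrightarrow> \<phi> u \<in> cycles_dim ord \<Gamma> (d + int r)"
    and "\<And>d z. z \<in> cycles_dim ord \<Delta> d \<Longrightarrow>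
        \<phi> z \<in> boundaries_dim ord \<Gamma> (d + int r) \<longleftrightarrow> z \<in> boundaries_dim ord \<Delta> d"
    and "\<And>d w. w \<in> cycles_dim ord \<Gamma> (d + int r) \<Longrightarrow>
        \<exists>z\<in>cycles_dim ord \<Delta> d. w - \<phi> z \<in> boundaries_dim ord \<Gamma> (d + int r)"
  using assms unfolding homology_equiv_def by blast+

text \<open>Only values on cycles matter, which later permits replacing iterated exterior products
  by polynomial products.\<close>

lemma homology_equiv_cong:
  assumes "homology_equiv ord r \<Delta> \<Gamma> \<phi>" "\<And>z. z \<in> cycles ord \<Delta> \<Longrightarrow> \<psi> z = \<phi> z"
  shows "homology_equiv ord r \<Delta> \<Gamma> \<psi>"
proof -
  have "\<psi> z = \<phi> z" if "z \<in> cycles_dim ord \<Delta> d" for z d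
    using assms(2) that cycles_dim_subset_cycles by blast
  then show ?thesis
    using assms cycles_add[of _ ord \<Delta>] unfolding homology_equiv_def by simp
qed

lemma homology_equiv_id: "homology_equiv ord 0 \<Delta> \<Delta> id"
proof -
  have "\<exists>z\<in>cycles_dim ord \<Delta> d. w - z \<in> boundaries_dim ord \<Delta> d" if "w \<in> cycles_dim ord \<Delta> d" for d w
    using that by (auto intro!: bexI[of _ w])
  then show ?thesis by (simp add: homology_equiv_def)
qed

lemma homology_equiv_diff:
  assumes "homology_equiv ord r \<Delta> \<Gamma> \<phi>" "u \<in> cycles_dim ord \<Delta> d" "v \<in> cycles_dim ord \<Delta> d"
  shows "\<phi> (u - v) = \<phi> u - \<phi> v"
proof -
  have "\<phi> (u - v + v) = \<phi> (u - v) + \<phi> v"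
    using assms cycles_dim_diff[OF assms(2,3)] cycles_dim_subset_cycles
    by (intro homology_equivD(1)[OF assms(1)]) blast+
  then show ?thesis by simp
qed

lemma homology_equiv_comp:
  assumes \<phi>: "homology_equiv ord r \<Delta> \<Lambda> \<phi>" and \<psi>: "homology_equiv ord s \<Lambda> \<Gamma> \<psi>"
  shows "homology_equiv ord (s + r) \<Delta> \<Gamma> (\<psi> \<circ> \<phi>)"
proof -
  have dim: "d + int (s + r) = d + int r + int s" for d
    by simp
  have "\<exists>z\<in>cycles_dim ord \<Delta> d. w - \<psi> (\<phi> z) \<in> boundaries_dim ord \<Gamma> (d + int r + int s)"
    if w: "w \<in> cycles_dim ord \<Gamma> (d + int r + int s)" for d w
  proof -
    obtain y where y: "y \<in> cycles_dim ord \<Lambda> (d + int r)"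
        "w - \<psi> y \<in> boundaries_dim ord \<Gamma> (d + int r + int s)"
      using homology_equivD(5)[OF \<psi> w] by blast
    obtain z where z: "z \<in> cycles_dim ord \<Delta> d" "y - \<phi> z \<in> boundaries_dim ord \<Lambda> (d + int r)"
      using homology_equivD(5)[OF \<phi> y(1)] by blast
    note \<phi>z = homology_equivD(3)[OF \<phi> z(1)]
    \<comment> \<open>The error of lifting through \<phi> is a boundary, and \<psi> sends it to a
      boundary, so it only adds to the error of lifting through \<psi>.\<close>
    have "\<psi> (y - \<phi> z) \<in> boundaries_dim ord \<Gamma> (d + int r + int s)"
      using homology_equivD(4)[OF \<psi> cycles_dim_diff[OF y(1) \<phi>z]] z(2) by blast
    then have "\<psi> y - \<psi> (\<phi> z) \<in> boundaries_dim ord \<Gamma> (d + int r + int s)"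
      by (simp only: homology_equiv_diff[OF \<psi> y(1) \<phi>z])
    from boundaries_dim_add[OF y(2) this] z(1) show ?thesis
      by (auto intro!: bexI[of _ z])
  qed
  then show ?thesis
    unfolding homology_equiv_def dim
    using homology_equivD[OF \<phi>] homology_equivD[OF \<psi>] by (auto simp: image_subset_iff)
qed

text \<open>Exterior counterpart of multiplication by \<open>a - b\<close>, the fundamental cycle of
  the 0-sphere on the points \<open>a\<close> and \<open>b\<close>.\<close>

definition suspend :: "'x::finite rel \<Rightarrow> 'x \<Rightarrow> 'x \<Rightarrow> 'x mpoly \<Rightarrow> 'x mpoly" where
  "suspend ord a b z = wedge ord a z - wedge ord b z"

lemma homology_equiv_suspend:
  fixes \<Gamma> :: "'x::finite set set"
  assumes ord: "linear_order ord" and dc: "down_closed \<Gamma>" and "a \<noteq> b"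
    and cone: "\<And>\<sigma>. \<sigma> \<in> \<Gamma> \<Longrightarrow> a \<notin> \<sigma> \<Longrightarrow> insert b \<sigma> \<in> \<Gamma>"
  shows "homology_equiv ord 1 (link \<Gamma> a) \<Gamma> (suspend ord a b)"
proof -
  let ?\<Lambda> = "link \<Gamma> a" and ?D = "{\<sigma> \<in> \<Gamma>. a \<notin> \<sigma>}" and ?N = "{\<sigma>. a \<notin> \<sigma>}"
  let ?\<phi> = "suspend ord a b" and ?d = "boundary ord"
  let ?Wa = "wedge ord a" and ?Wb = "wedge ord b"
  \<comment> \<open>The link lies in the deletion \<open>?D\<close>. As \<open>?D\<close> is a cone
    with apex \<open>b\<close>, \<open>?Wb\<close> maps chains of either into
    \<open>?D\<close>.\<close>
  have link_D: "?\<Lambda> \<subseteq> ?D"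
    using dc by (auto simp: link_def down_closed_def)
  have dcD: "down_closed ?D"
    using dc unfolding down_closed_def by blast
  have Wa: "?Wa z \<in> chains_dim \<Gamma> (d + 1)" if "z \<in> chains_dim ?\<Lambda> d" for z d
    using that by (rule wedge_in_chains_dim) (auto simp: link_def)
  have WbD: "?Wb z \<in> chains_dim ?D (d + 1)" if "z \<in> chains_dim ?D d" for z d
    using that cone \<open>a \<noteq> b\<close> by (intro wedge_in_chains_dim) auto
  have Wb: "?Wb z \<in> chains_dim ?D (d + 1)" if "z \<in> chains_dim ?\<Lambda> d" for z d
    using that WbD chains_dim_mono[OF link_D] by blast
  have D_\<Gamma>: "z \<in> chains_dim \<Gamma> d" if "z \<in> chains_dim ?D d" for z d
    using that chains_dim_mono[of ?D \<Gamma>] by blast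
  have D_N: "z \<in> chains ?N" if "z \<in> chains_dim ?D d" for z d
    using that chains_dim_subset_chains chains_mono[of ?D ?N] by blast
  have \<Lambda>_N: "z \<in> chains ?N" if "z \<in> chains_dim ?\<Lambda> d" for z d
    using that chains_dim_mono[OF link_D] D_N by blast
  have \<phi>_dim: "?\<phi> z \<in> chains_dim \<Gamma> (d + 1)" if "z \<in> chains_dim ?\<Lambda> d" for z d
    unfolding suspend_def using Wa Wb D_\<Gamma> that by (blast intro: chains_dim_diff)
  have dW: "?d (wedge ord x z) = z - wedge ord x (?d z)" if "z \<in> chains_dim \<Delta> d" for x z \<Delta> d
    using that chains_dim_subset_chains boundary_wedge[OF ord] by blast
  have d\<phi>: "?d (?\<phi> z) = - ?\<phi> (?d z)" if "z \<in> chains \<Delta>" for z \<Delta>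
    unfolding suspend_def boundary_diff boundary_wedge[OF ord that] by simp
  \<comment> \<open>\<open>chains_decompose\<close> by dimension: the part stripped of
    \<open>a\<close> drops by one dimension, the other part keeps its own.\<close>
  have split: thesis
    if u: "u \<in> chains_dim \<Gamma> (d + 1)"
      and *: "\<And>u1 u0. u1 \<in> chains_dim ?\<Lambda> d \<Longrightarrow> u0 \<in> chains_dim ?D (d + 1) \<Longrightarrow> u = ?Wa u1 + u0 \<Longrightarrow> thesis"
    for u d thesis
  proof -
    obtain u1 u0 where u1: "u1 \<in> chains (link {\<sigma> \<in> \<Gamma>. int (card \<sigma>) = d + 1 + 1} a)"
      and u0: "u0 \<in> chains {\<sigma> \<in> {\<sigma> \<in> \<Gamma>. int (card \<sigma>) = d + 1 + 1}. a \<notin> \<sigma>}" and eq: "u = ?Wa u1 + u0"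
      using chains_decompose u unfolding chains_dim_def by blast
    have "link {\<sigma> \<in> \<Gamma>. int (card \<sigma>) = d + 1 + 1} a \<subseteq> {\<sigma> \<in> ?\<Lambda>. int (card \<sigma>) = d + 1}"
      by (auto simp: link_def)
    with u1 have "u1 \<in> chains_dim ?\<Lambda> d"
      unfolding chains_dim_def using chains_mono by blast
    moreover have "u0 \<in> chains_dim ?D (d + 1)"
      using u0 by (simp add: chains_dim_def conj_ac)
    ultimately show thesis using * eq by blast
  qed
  have dD: "?d z \<in> chains_dim ?D d" if "z \<in> chains_dim ?D (d + 1)" for z d
    using boundary_in_chains_dim[OF dcD that] .
  have d\<Lambda>: "?d z \<in> chains ?N" if "z \<in> chains_dim ?\<Lambda> d" for z d
    using \<Lambda>_N[OF that] by (rule boundary_in_chains) auto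

  have inj: "z \<in> boundaries_dim ord ?\<Lambda> d"
    if z: "z \<in> cycles_dim ord ?\<Lambda> d" and bd: "?\<phi> z \<in> boundaries_dim ord \<Gamma> (d + 1)" for z d
  proof -
    obtain u where u: "u \<in> chains_dim \<Gamma> (d + 1 + 1)" "?\<phi> z = ?d u"
      using bd by (auto simp: boundaries_dim_def)
    obtain u1 u0 where u1: "u1 \<in> chains_dim ?\<Lambda> (d + 1)" and u0: "u0 \<in> chains_dim ?D (d + 1 + 1)"
      and eq: "u = ?Wa u1 + u0"
      using split[OF u(1)] by blast
    have z': "z \<in> chains_dim ?\<Lambda> d" using z by (simp add: cycles_dim_def)
    have "?Wa z - ?Wb z = u1 - ?Wa (?d u1) + ?d u0"
      using u(2) unfolding eq suspend_def boundary_add dW[OF u1] .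
    \<comment> \<open>All faces containing \<open>a\<close> are gathered under \<open>?Wa\<close>,
      and the right-hand side avoids \<open>a\<close>. So \<open>z + ?d u1\<close> vanishes, and
      \<open>- u1\<close> is the chain of the link that \<open>z\<close> bounds.\<close>
    then have "?Wa (z + ?d u1) = u1 + ?d u0 + ?Wb z"
      by (simp add: wedge_add algebra_simps)
    moreover have "z + ?d u1 \<in> chains ?N"
      by (intro chains_add \<Lambda>_N[OF z'] d\<Lambda>[OF u1])
    moreover have "u1 + ?d u0 + ?Wb z \<in> chains ?N"
      by (intro chains_add \<Lambda>_N[OF u1] D_N[OF dD[OF u0]] D_N[OF Wb[OF z']])
    ultimately have "z + ?d u1 = 0"
      using wedge_eq_imp_0 by blast
    then have "z = ?d (- u1)"
      by (simp add: boundary_uminus eq_neg_iff_add_eq_0)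
    then show ?thesis
      using u1 by (auto simp: boundaries_dim_def intro!: imageI chains_dim_uminus)
  qed

  have pres: "?\<phi> z \<in> boundaries_dim ord \<Gamma> (d + 1)" if "z \<in> boundaries_dim ord ?\<Lambda> d" for z d
  proof -
    obtain u where u: "u \<in> chains_dim ?\<Lambda> (d + 1)" "z = ?d u"
      using \<open>z \<in> boundaries_dim ord ?\<Lambda> d\<close> by (auto simp: boundaries_dim_def)
    have "u \<in> chains ?\<Lambda>"
      using u chains_dim_subset_chains by blast
    \<comment> \<open>The map raises dimension by one and anticommutes with the boundary; hence the
      sign of the witness.\<close>
    then have "?\<phi> z = ?d (- ?\<phi> u)"
      using d\<phi> u(2) by (simp add: boundary_uminus)
    then show ?thesis
      using \<phi>_dim[OF u(1)] by (auto simp: boundaries_dim_def intro!: imageI chains_dim_uminus)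
  qed

  have surj: "\<exists>z\<in>cycles_dim ord ?\<Lambda> d. w - ?\<phi> z \<in> boundaries_dim ord \<Gamma> (d + 1)"
    if w: "w \<in> cycles_dim ord \<Gamma> (d + 1)" for w d
  proof -
    obtain w1 w0 where w1: "w1 \<in> chains_dim ?\<Lambda> d" and w0: "w0 \<in> chains_dim ?D (d + 1)"
      and eq: "w = ?Wa w1 + w0"
      using split[of w d] w unfolding cycles_dim_def by blast
    have "?d w = 0" using w by (simp add: cycles_dim_def)
    \<comment> \<open>Again the part with \<open>a\<close> is separated: both sides must vanish, so
      \<open>w1\<close> is a cycle and the boundary of \<open>w0\<close> is
      \<open>- w1\<close>.\<close>
    then have *: "?Wa (?d w1) = w1 + ?d w0"
      by (simp add: eq boundary_add dW[OF w1] algebra_simps eq_neg_iff_add_eq_0)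
    moreover have "w1 + ?d w0 \<in> chains ?N"
      by (intro chains_add \<Lambda>_N[OF w1] D_N[OF dD[OF w0]])
    ultimately have dw1: "?d w1 = 0"
      using wedge_eq_imp_0 d\<Lambda>[OF w1] by blast
    with * have dw0: "?d w0 = - w1"
      by (simp add: eq_neg_iff_add_eq_0 add.commute)
    \<comment> \<open>This is \<open>w - ?\<phi> w1\<close>: the contributions of \<open>?Wa\<close>
      cancel and a cycle of the cone \<open>?D\<close> is left, which is the boundary of
      \<open>?Wb v\<close>.\<close>
    define v where "v = w0 + ?Wb w1"
    have v: "v \<in> chains_dim ?D (d + 1)"
      unfolding v_def by (intro chains_dim_add w0 Wb w1)
    have "?d v = 0"
      by (simp add: v_def boundary_add dW[OF w1] dw0 dw1)
    then have "?d (?Wb v) = v"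
      by (simp add: dW[OF v])
    moreover have "?Wb v \<in> chains_dim \<Gamma> (d + 1 + 1)"
      by (intro D_\<Gamma> WbD v)
    ultimately have "v \<in> boundaries_dim ord \<Gamma> (d + 1)"
      unfolding boundaries_dim_def by (metis imageI)
    moreover have "w - ?\<phi> w1 = v"
      by (simp add: eq v_def suspend_def)
    ultimately show ?thesis
      using w1 dw1 by (auto simp: cycles_dim_def intro!: bexI[of _ w1])
  qed

  have cyc_dim: "?\<phi> ` cycles_dim ord ?\<Lambda> d \<subseteq> cycles_dim ord \<Gamma> (d + 1)" for d
  proof (rule image_subsetI)
    fix z assume "z \<in> cycles_dim ord ?\<Lambda> d"
    then have z: "z \<in> chains_dim ?\<Lambda> d" "?d z = 0"
      by (auto simp: cycles_dim_def)
    then have "?d (?\<phi> z) = 0"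
      by (simp add: suspend_def boundary_diff dW[OF z(1)])
    then show "?\<phi> z \<in> cycles_dim ord \<Gamma> (d + 1)"
      using \<phi>_dim[OF z(1)] by (simp add: cycles_dim_def)
  qed
  have cyc: "?\<phi> ` cycles ord ?\<Lambda> \<subseteq> cycles ord \<Gamma>"
  proof (rule image_subsetI)
    fix z assume "z \<in> cycles ord ?\<Lambda>"
    then have z: "z \<in> chains ?\<Lambda>" "?d z = 0"
      by (auto simp: cycles_def)
    have "?Wa z \<in> chains \<Gamma>" "?Wb z \<in> chains \<Gamma>"
      using z(1) link_D cone by (auto intro!: wedge_in_chains[OF z(1)] simp: link_def)
    then have "?\<phi> z \<in> chains \<Gamma>"
      unfolding suspend_def by (rule chains_diff)
    moreover have "?d (?\<phi> z) = 0"
      by (simp add: suspend_def boundary_diff boundary_wedge[OF ord z(1)] z(2))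
    ultimately show "?\<phi> z \<in> cycles ord \<Gamma>"
      by (simp add: cycles_def)
  qed
  have "?\<phi> (u + v) = ?\<phi> u + ?\<phi> v" for u v
    by (simp add: suspend_def wedge_add)
  then show ?thesis
    unfolding homology_equiv_def using cyc cyc_dim inj pres surj by auto
qed

section \<open>From cycles and boundaries to homology groups\<close>

lemma comm_group_add_group:
  assumes "0 \<in> S" "\<And>u v. u \<in> S \<Longrightarrow> v \<in> S \<Longrightarrow> u + v \<in> S" "\<And>u. u \<in> S \<Longrightarrow> - u \<in> S"
  shows "comm_group (add_group S)"
  by (rule comm_groupI)
     (use assms in \<open>auto simp: add_group_def algebra_simps intro: bexI[where x = "- u" for u]\<close>)

lemma comm_group_cycles_dim: "comm_group (add_group (cycles_dim ord \<Delta> d))"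
  by (intro comm_group_add_group cycles_dim_add cycles_dim_uminus cycles_dim_0)

lemma normal_boundaries_dim:
  assumes "linear_order ord" "down_closed \<Delta>"
  shows "boundaries_dim ord \<Delta> d \<lhd> add_group (cycles_dim ord \<Delta> d)"
proof -
  interpret comm_group "add_group (cycles_dim ord \<Delta> d)"
    by (rule comm_group_cycles_dim)
  have inv: "inv\<^bsub>add_group (cycles_dim ord \<Delta> d)\<^esub> u = - u" if "u \<in> cycles_dim ord \<Delta> d" for u
    using that by (intro inv_equality) (auto simp: add_group_def cycles_dim_uminus)
  have "subgroup (boundaries_dim ord \<Delta> d) (add_group (cycles_dim ord \<Delta> d))"
  proof (rule subgroupI)
    show "boundaries_dim ord \<Delta> d \<subseteq> carrier (add_group (cycles_dim ord \<Delta> d))"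
      using boundaries_dim_subset_cycles_dim[OF assms] by (simp add: add_group_def)
    show "boundaries_dim ord \<Delta> d \<noteq> {}"
      using boundaries_dim_0 by blast
  next
    fix u assume u: "u \<in> boundaries_dim ord \<Delta> d"
    then show "inv\<^bsub>add_group (cycles_dim ord \<Delta> d)\<^esub> u \<in> boundaries_dim ord \<Delta> d"
      using boundaries_dim_subset_cycles_dim[OF assms] inv boundaries_dim_uminus by fastforce
  next
    fix u v assume "u \<in> boundaries_dim ord \<Delta> d" "v \<in> boundaries_dim ord \<Delta> d"
    then show "u \<otimes>\<^bsub>add_group (cycles_dim ord \<Delta> d)\<^esub> v \<in> boundaries_dim ord \<Delta> d"
      by (simp add: add_group_def boundaries_dim_add)
  qed
  then show ?thesis by (rule subgroup_imp_normal)
qed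

lemma homology_class_eq: "homology_class ord \<Delta> d z = {u + z |u. u \<in> boundaries_dim ord \<Delta> d}"
  by (auto simp: homology_class_def r_coset_def add_group_def)

lemma homology_class_eq_iff:
  "homology_class ord \<Delta> d z = homology_class ord \<Delta> d w \<longleftrightarrow> z - w \<in> boundaries_dim ord \<Delta> d"
proof
  assume "homology_class ord \<Delta> d z = homology_class ord \<Delta> d w"
  moreover have "z \<in> homology_class ord \<Delta> d z"
    unfolding homology_class_eq by (force intro: exI[of _ 0])
  ultimately obtain u where "u \<in> boundaries_dim ord \<Delta> d" "z = u + w"
    unfolding homology_class_eq by auto
  then show "z - w \<in> boundaries_dim ord \<Delta> d" by simp
next
  assume *: "z - w \<in> boundaries_dim ord \<Delta> d"
  have "u + z = (u + (z - w)) + w" "u + w = (u - (z - w)) + z" for u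
    by simp_all
  then show "homology_class ord \<Delta> d z = homology_class ord \<Delta> d w"
    unfolding homology_class_eq
    using boundaries_dim_add[OF _ *] boundaries_dim_diff[OF _ *] by blast
qed

text \<open>First isomorphism theorem for the map from cycles of \<Delta> to the homology of
  \<Gamma>: the fourth clause of \<open>homology_equiv\<close> identifies its kernel with the
  boundaries, and the fifth gives surjectivity.\<close>

lemma quasi_iso_if_homology_equiv:
  assumes ord: "linear_order ord" and dc: "down_closed \<Delta>" "down_closed \<Gamma>"
    and \<phi>: "homology_equiv ord r \<Delta> \<Gamma> \<phi>"
  shows "quasi_iso ord r \<Delta> \<Gamma> \<phi>"
  unfolding quasi_iso_def
proof (intro conjI allI)
  show "\<phi> \<in> hom (add_group (cycles ord \<Delta>)) (add_group (cycles ord \<Gamma>))"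
    using homology_equivD(1,2)[OF \<phi>] by (auto simp: hom_def add_group_def)
next
  fix d
  show "\<phi> ` cycles_dim ord \<Delta> d \<subseteq> cycles_dim ord \<Gamma> (d + int r)"
    using homology_equivD(3)[OF \<phi>] by blast
next
  fix d
  let ?G = "add_group (cycles_dim ord \<Delta> d)" and ?e = "d + int r"
  let ?B = "boundaries_dim ord \<Delta> d" and ?C = "boundaries_dim ord \<Gamma> ?e"
  define h where "h z = homology_class ord \<Gamma> ?e (\<phi> z)" for z
  interpret NC: normal ?C "add_group (cycles_dim ord \<Gamma> ?e)"
    by (rule normal_boundaries_dim[OF ord dc(2)])
  have "\<phi> \<in> hom ?G (add_group (cycles_dim ord \<Gamma> ?e))"
    using homology_equivD(1,3)[OF \<phi>] cycles_dim_subset_cycles by (fastforce simp: hom_def add_group_def)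
  from hom_compose[OF this NC.r_coset_hom_Mod]
  have h_hom: "h \<in> hom ?G (homology ord \<Gamma> ?e)"
    by (simp add: h_def[abs_def] homology_def homology_class_def comp_def)
  interpret group_hom ?G "homology ord \<Gamma> ?e" h
    using comm_group_cycles_dim[of ord \<Delta> d] h_hom NC.factorgroup_is_group
    by (simp add: group_hom_def group_hom_axioms_def comm_group_def homology_def)
  have one: "\<one>\<^bsub>homology ord \<Gamma> ?e\<^esub> = homology_class ord \<Gamma> ?e 0"
    unfolding homology_class_eq by (simp add: homology_def FactGroup_def)
  have ker: "kernel ?G (homology ord \<Gamma> ?e) h = ?B"
    using homology_equivD(4)[OF \<phi>, of _ d] boundaries_dim_subset_cycles_dim[OF ord dc(1), of d]
    unfolding kernel_def one h_def homology_class_eq_iff by (auto simp: add_group_def)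
  have "h ` carrier ?G = carrier (homology ord \<Gamma> ?e)"
  proof
    show "h ` carrier ?G \<subseteq> carrier (homology ord \<Gamma> ?e)"
      by auto
    show "carrier (homology ord \<Gamma> ?e) \<subseteq> h ` carrier ?G"
    proof
      fix c assume "c \<in> carrier (homology ord \<Gamma> ?e)"
      then obtain w where w: "w \<in> cycles_dim ord \<Gamma> ?e" "c = homology_class ord \<Gamma> ?e w"
        by (auto simp: homology_def FactGroup_def RCOSETS_def homology_class_def add_group_def)
      then obtain z where "z \<in> cycles_dim ord \<Delta> d" "w - \<phi> z \<in> ?C"
        using homology_equivD(5)[OF \<phi>] by blast
      then have "c = h z" "z \<in> carrier ?G"
        by (auto simp: w(2) h_def homology_class_eq_iff add_group_def)
      then show "c \<in> h ` carrier ?G" by blast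
    qed
  qed
  from FactGroup_iso_set[OF this]
  have iso: "(\<lambda>X. the_elem (h ` X)) \<in> iso (homology ord \<Delta> d) (homology ord \<Gamma> ?e)"
    unfolding ker homology_def[of ord \<Delta>] .
  \<comment> \<open>The isomorphism is given through images of cosets; \<open>h\<close> is constant
    on each coset, so the image is a singleton.\<close>
  have "the_elem (h ` homology_class ord \<Delta> d z) = h z" if z: "z \<in> cycles_dim ord \<Delta> d" for z
  proof -
    have "h (u + z) = h z" if u: "u \<in> ?B" for u
    proof -
      have "u + z \<in> cycles_dim ord \<Delta> d"
        using u z boundaries_dim_subset_cycles_dim[OF ord dc(1), of d] by (blast intro: cycles_dim_add)
      from homology_equiv_diff[OF \<phi> this z] u show ?thesis
        unfolding h_def homology_class_eq_iff
        using homology_equivD(4)[OF \<phi>, of u d] boundaries_dim_subset_cycles_dim[OF ord dc(1), of d]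
        by auto
    qed
    then have "h ` homology_class ord \<Delta> d z = {h z}"
      unfolding homology_class_eq using boundaries_dim_0[of ord \<Delta> d] by (auto simp: image_iff)
    then show ?thesis by simp
  qed
  with iso show "\<exists>h \<in> iso (homology ord \<Delta> d) (homology ord \<Gamma> ?e). \<forall>z \<in> cycles_dim ord \<Delta> d.
      h (homology_class ord \<Delta> d z) = homology_class ord \<Gamma> ?e (\<phi> z)"
    unfolding h_def by (intro bexI[rotated]) auto
qed


section \<open>Iterated suspensions\<close>

text \<open>The last pair acts first: a cycle of the core is carried outwards through the successive
  links.\<close>

fun iter_suspend :: "'x::finite rel \<Rightarrow> 'x list \<Rightarrow> 'x list \<Rightarrow> 'x mpoly \<Rightarrow> 'x mpoly" where
  "iter_suspend ord (a # as) (b # bs) = suspend ord a b \<circ> iter_suspend ord as bs"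
| "iter_suspend ord _ _ = id"

text \<open>The combinatorial content of a sequence of dominations: at every stage the deletion of
  \<open>a\<close> is a cone with apex \<open>b\<close>, and the next stage takes place in the link
  of \<open>a\<close>.\<close>

fun dominating_seq :: "'x set set \<Rightarrow> 'x list \<Rightarrow> 'x list \<Rightarrow> bool" where
  "dominating_seq \<Gamma> (a # as) (b # bs) \<longleftrightarrow>
     a \<noteq> b \<and> (\<forall>\<sigma>\<in>\<Gamma>. a \<notin> \<sigma> \<longrightarrow> insert b \<sigma> \<in> \<Gamma>) \<and> dominating_seq (link \<Gamma> a) as bs"
| "dominating_seq \<Gamma> as bs \<longleftrightarrow> as = [] \<and> bs = []"

lemma down_closed_foldl_link: "down_closed \<Gamma> \<Longrightarrow> down_closed (foldl link \<Gamma> as)"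
  by (induction as arbitrary: \<Gamma>) (auto simp: down_closed_link)

lemma homology_equiv_iter_suspend:
  assumes "linear_order ord" "down_closed \<Gamma>" "dominating_seq \<Gamma> as bs"
  shows "homology_equiv ord (length as) (foldl link \<Gamma> as) \<Gamma> (iter_suspend ord as bs)"
  using assms(2,3)
proof (induction \<Gamma> as bs rule: dominating_seq.induct)
  case (1 \<Gamma> a as b bs)
  then have equiv: "homology_equiv ord (length as) (foldl link (link \<Gamma> a) as) (link \<Gamma> a)
      (iter_suspend ord as bs)"
    by (simp add: down_closed_link)
  have "homology_equiv ord 1 (link \<Gamma> a) \<Gamma> (suspend ord a b)"
    using 1 assms(1) by (intro homology_equiv_suspend) auto
  from homology_equiv_comp[OF equiv this] show ?case
    by (simp add: comp_def)
qed (auto simp: homology_equiv_id)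

text \<open>
  A face of \<open>\<Gamma>\<close> containing \<open>a\<close> occurs in \<open>(a - b) z\<close>, for \<open>z\<close> a chain of the link of \<open>a\<close>, only as
  a multiple of \<open>a\<close>, and any other face only as a multiple of \<open>b\<close>. So the signs by which the exterior
  product differs from the polynomial product depend only on the resulting face.
\<close>

fun iter_sign :: "'x rel \<Rightarrow> 'x list \<Rightarrow> 'x list \<Rightarrow> 'x set \<Rightarrow> int" where
  "iter_sign ord (a # as) (b # bs) \<tau> =
     (if a \<in> \<tau> then pos_sign ord a \<tau> * iter_sign ord as bs (\<tau> - {a})
      else pos_sign ord b \<tau> * iter_sign ord as bs (\<tau> - {b}))"
| "iter_sign ord _ _ \<tau> = 1"

definition sign_map :: "'x::finite rel \<Rightarrow> 'x list \<Rightarrow> 'x list \<Rightarrow> 'x mpoly \<Rightarrow> 'x mpoly" where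
  "sign_map ord as bs = lin_ext (\<lambda>\<tau>. of_int (iter_sign ord as bs \<tau>) * face_mon \<tau>)"

lemma iter_sign_cases: "iter_sign ord as bs \<tau> = 1 \<or> iter_sign ord as bs \<tau> = - 1"
proof (induction ord as bs \<tau> rule: iter_sign.induct)
  case (1 ord a as b bs \<tau>)
  then show ?case
    using pos_sign_cases[of ord a \<tau>] pos_sign_cases[of ord b \<tau>] by (cases "a \<in> \<tau>") auto
qed auto

lemma face_sign_map_sign_map: "face_sign_map \<Delta> (sign_map ord as bs)"
  unfolding face_sign_map_def
proof (intro conjI ballI)
  show "additive (sign_map ord as bs)"
    by (simp add: additive_def sign_map_def lin_ext_add)
  fix \<sigma>
  show "sign_map ord as bs (face_mon \<sigma>) = face_mon \<sigma> \<or> sign_map ord as bs (face_mon \<sigma>) = - face_mon \<sigma>"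
    using iter_sign_cases[of ord as bs \<sigma>] by (auto simp: sign_map_def)
qed

lemma suspend_eq_lin_ext: "suspend ord a b z = lin_ext (\<lambda>\<sigma>. wedge_face ord a \<sigma> - wedge_face ord b \<sigma>) z"
  by (simp add: suspend_def wedge_def lin_ext_minus_fun)

text \<open>Since \<sigma> avoids \<open>a\<close> and \<open>a\<close> differs from
  \<open>b\<close>, the face \<open>insert a \<sigma>\<close> contains \<open>a\<close> and
  \<open>insert b \<sigma>\<close> does not. So \<open>iter_sign\<close> takes the matching branch
  and recovers \<sigma>; if \<open>b\<close> already lies in \<sigma>, both products by
  \<open>b\<close> are zero.\<close>

lemma suspend_sign_map:
  assumes u: "u \<in> chains {\<sigma>. a \<notin> \<sigma>}" and "a \<noteq> b"
  shows "suspend ord a b (sign_map ord as bs u)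
    = sign_map ord (a # as) (b # bs) (lin_ext (\<lambda>\<sigma>. mult_face a \<sigma> - mult_face b \<sigma>) u)"
  unfolding suspend_eq_lin_ext sign_map_def lin_ext_compose
proof (rule lin_ext_cong[OF u])
  fix \<sigma> assume "\<sigma> \<in> {\<sigma>. a \<notin> \<sigma>}"
  then have "a \<notin> \<sigma>" by simp
  then have "lin_ext (\<lambda>\<tau>. of_int (iter_sign ord (a # as) (b # bs) \<tau>) * face_mon \<tau>) (mult_face a \<sigma>)
      = of_int (iter_sign ord as bs \<sigma>) * wedge_face ord a \<sigma>"
    by (simp add: mult_face_def wedge_face_def algebra_simps)
  moreover have "lin_ext (\<lambda>\<tau>. of_int (iter_sign ord (a # as) (b # bs) \<tau>) * face_mon \<tau>) (mult_face b \<sigma>)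
      = of_int (iter_sign ord as bs \<sigma>) * wedge_face ord b \<sigma>"
    using \<open>a \<notin> \<sigma>\<close> \<open>a \<noteq> b\<close> by (simp add: mult_face_def wedge_face_def algebra_simps)
  ultimately show "lin_ext (\<lambda>\<sigma>. wedge_face ord a \<sigma> - wedge_face ord b \<sigma>) (of_int (iter_sign ord as bs \<sigma>) * face_mon \<sigma>)
      = lin_ext (\<lambda>\<tau>. of_int (iter_sign ord (a # as) (b # bs) \<tau>) * face_mon \<tau>) (mult_face a \<sigma> - mult_face b \<sigma>)"
    by (simp add: lin_ext_of_int_mult lin_ext_diff right_diff_distrib)
qed

lemma dominating_seq_length: "dominating_seq \<Gamma> as bs \<Longrightarrow> length bs = length as"
  by (induction \<Gamma> as bs rule: dominating_seq.induct) auto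

text \<open>The membership is proved along with the equation because it places the intermediate
  product in the link of \<open>a\<close>, whose faces avoid \<open>a\<close>, as
  \<open>suspend_sign_map\<close> requires.\<close>

lemma iter_suspend_eq_sign_map:
  fixes \<Gamma> :: "'x::finite set set"
  assumes "down_closed \<Gamma>" "dominating_seq \<Gamma> as bs" "z \<in> chains (foldl link \<Gamma> as)"
  shows "cross_mult as bs z \<in> chains \<Gamma> \<and>
    iter_suspend ord as bs z = sign_map ord as bs (cross_mult as bs z)"
  using assms
proof (induction \<Gamma> as bs rule: dominating_seq.induct)
  case (1 \<Gamma> a as b bs)
  define u where "u = cross_mult as bs z"
  have u: "u \<in> chains (link \<Gamma> a)" "iter_suspend ord as bs z = sign_map ord as bs u"
    using 1 by (auto simp: u_def down_closed_link)
  have cm: "cross_mult (a # as) (b # bs) z = lin_ext (\<lambda>\<sigma>. mult_face a \<sigma> - mult_face b \<sigma>) u"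
    unfolding u_def using 1 dominating_seq_length by (intro cross_mult_Cons) auto
  have "mult_face a \<sigma> - mult_face b \<sigma> \<in> chains \<Gamma>" if "\<sigma> \<in> link \<Gamma> a" for \<sigma>
  proof -
    \<comment> \<open>\<sigma> itself is a face without \<open>a\<close>, so the cone condition
      supplies the face with \<open>b\<close> added.\<close>
    have "insert a \<sigma> \<in> \<Gamma>" "\<sigma> \<in> \<Gamma>" "a \<notin> \<sigma>"
      using that \<open>down_closed \<Gamma>\<close> by (auto simp: link_def down_closed_def)
    with 1 show ?thesis
      by (intro chains_diff) (auto simp: mult_face_def)
  qed
  then have "lin_ext (\<lambda>\<sigma>. mult_face a \<sigma> - mult_face b \<sigma>) u \<in> chains \<Gamma>"
    by (rule lin_ext_in_chains[OF u(1)])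
  moreover have "u \<in> chains {\<sigma>. a \<notin> \<sigma>}"
    using u(1) chains_mono[of "link \<Gamma> a" "{\<sigma>. a \<notin> \<sigma>}"] by (auto simp: link_def)
  ultimately show ?case
    using u(2) 1 by (simp add: cm suspend_sign_map)
qed (auto simp: cross_mult_Nil sign_map_def lin_ext_id)

text \<open>The order condition in recursive form, with \<open>V\<close> for the vertices of the
  core. The comparison with later variables is weak, since \<open>b\<close> may recur among
  them.\<close>

fun ascending :: "'x rel \<Rightarrow> 'x set \<Rightarrow> 'x list \<Rightarrow> 'x list \<Rightarrow> bool" where
  "ascending ord V (a # as) (b # bs) \<longleftrightarrow>
     (a, b) \<in> ord \<and> a \<noteq> b \<and> (\<forall>y\<in>set as \<union> set bs \<union> V. (b, y) \<in> ord) \<and> ascending ord V as bs"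
| "ascending ord V as bs \<longleftrightarrow> as = [] \<and> bs = []"

lemma ascending_length: "ascending ord V as bs \<Longrightarrow> length bs = length as"
  by (induction ord V as bs rule: ascending.induct) auto

lemma wedge_face_eq_mult_face:
  assumes "\<And>y. y \<in> \<sigma> \<Longrightarrow> (y, a) \<in> ord \<Longrightarrow> y = a"
  shows "wedge_face ord a \<sigma> = mult_face a \<sigma>"
proof -
  have "{y \<in> \<sigma>. (y, a) \<in> ord \<and> y \<noteq> a} = {}" using assms by auto
  then have "pos_sign ord a \<sigma> = 1"
    unfolding pos_sign_def by (simp only: card.empty power_0)
  then show ?thesis
    by (simp add: wedge_face_def)
qed

text \<open>When \<open>a\<close> and \<open>b\<close> are multiplied in, the faces present use only
  later variables and \<open>V\<close>. None of these strictly precedes \<open>a\<close> or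
  \<open>b\<close>, so every sign is 1. The membership tracks the variables in use.\<close>

lemma iter_suspend_eq_cross_mult:
  fixes V :: "'x::finite set"
  assumes "linear_order ord" "ascending ord V as bs" "z \<in> chains {\<sigma>. \<sigma> \<subseteq> V}"
  shows "cross_mult as bs z \<in> chains {\<sigma>. \<sigma> \<subseteq> set as \<union> set bs \<union> V} \<and>
    iter_suspend ord as bs z = cross_mult as bs z"
  using assms
proof (induction ord V as bs rule: ascending.induct)
  case (1 ord V a as b bs)
  let ?V = "set as \<union> set bs \<union> V"
  define u where "u = cross_mult as bs z"
  have u: "u \<in> chains {\<sigma>. \<sigma> \<subseteq> ?V}" "iter_suspend ord as bs z = u"
    using 1 by (auto simp: u_def)
  have cm: "cross_mult (a # as) (b # bs) z = lin_ext (\<lambda>\<sigma>. mult_face a \<sigma> - mult_face b \<sigma>) u"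
    unfolding u_def using 1 ascending_length by (intro cross_mult_Cons) auto
  have "trans ord" "antisym ord"
    using \<open>linear_order ord\<close> by (auto simp: linear_order_on_def partial_order_on_def preorder_on_def)
  moreover have "(a, b) \<in> ord" "a \<noteq> b" "\<And>y. y \<in> ?V \<Longrightarrow> (b, y) \<in> ord"
    using 1 by auto
  ultimately have "y \<in> ?V \<Longrightarrow> (y, a) \<in> ord \<Longrightarrow> y = a" "y \<in> ?V \<Longrightarrow> (y, b) \<in> ord \<Longrightarrow> y = b" for y
    by (meson antisymD transD)+
  then have "suspend ord a b u = lin_ext (\<lambda>\<sigma>. mult_face a \<sigma> - mult_face b \<sigma>) u"
    unfolding suspend_eq_lin_ext
    by (intro lin_ext_cong[OF u(1)] arg_cong2[where f = minus] wedge_face_eq_mult_face) blast+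
  moreover have "lin_ext (\<lambda>\<sigma>. mult_face a \<sigma> - mult_face b \<sigma>) u
      \<in> chains {\<sigma>. \<sigma> \<subseteq> set (a # as) \<union> set (b # bs) \<union> V}"
    by (intro lin_ext_in_chains[OF u(1)] chains_diff) (auto simp: mult_face_def)
  ultimately show ?case
    using u(2) by (simp add: cm)
qed (auto simp: cross_mult_Nil)

lemma ascendingI:
  assumes "linear_order ord" "length bs = length as"
    and "\<And>i. i < length as \<Longrightarrow> (as ! i, bs ! i) \<in> ord \<and> as ! i \<noteq> bs ! i"
    and "\<And>i. Suc i < length as \<Longrightarrow> (bs ! i, as ! Suc i) \<in> ord"
    and "\<And>x. as \<noteq> [] \<Longrightarrow> x \<in> V \<Longrightarrow> (last bs, x) \<in> ord"
  shows "ascending ord V as bs"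
  using assms(2-)
proof (induction bs as rule: list_induct2)
  case (Cons b bs a as)
  have IH: "ascending ord V as bs"
  proof (rule Cons.IH)
    show "(as ! i, bs ! i) \<in> ord \<and> as ! i \<noteq> bs ! i" if "i < length as" for i
      using Cons.prems(1)[of "Suc i"] that by simp
    show "(bs ! i, as ! Suc i) \<in> ord" if "Suc i < length as" for i
      using Cons.prems(2)[of "Suc i"] that by simp
    show "(last bs, x) \<in> ord" if "as \<noteq> []" "x \<in> V" for x
      using Cons.prems(3)[of x] that Cons.hyps by (auto split: if_splits)
  qed
  have "(b, y) \<in> ord" if "y \<in> set as \<union> set bs \<union> V" for y
  proof (cases as)
    case Nil
    then show ?thesis using that Cons.prems(3)[of y] Cons.hyps by simp
  next
    case (Cons a' as')
    with Cons.hyps obtain b' bs' where bs: "bs = b' # bs'" by (cases bs) auto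
    \<comment> \<open>\<open>b\<close> is at most \<open>a'\<close>, which precedes
      \<open>b'\<close>, which by induction is at most everything after it; transitivity does the
      rest.\<close>
    have "(b, a') \<in> ord" using Cons.prems(2)[of 0] Cons by simp
    moreover have "(a', b') \<in> ord" "\<And>y. y \<in> set as' \<union> set bs' \<union> V \<Longrightarrow> (b', y) \<in> ord"
      using IH unfolding Cons bs by auto
    moreover have "trans ord"
      using assms(1) by (auto simp: linear_order_on_def partial_order_on_def preorder_on_def)
    ultimately show ?thesis
      using that unfolding Cons bs by (auto dest: transD)
  qed
  then show ?case
    using IH Cons.prems(1)[of 0] by simp
qed simp


section \<open>Monomial ideals\<close>

lemma module_mult: "module ((*) :: 'a::comm_ring_1 \<Rightarrow> 'a \<Rightarrow> 'a)"
  by unfold_locales (simp_all add: algebra_simps)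

text \<open>Monomial ideals described without generators, a form that passes directly to colon
  ideals.\<close>

definition monomially_closed :: "'x mpoly set \<Rightarrow> bool" where
  "monomially_closed J \<longleftrightarrow>
     module.subspace (*) J \<and> (\<forall>f\<in>J. \<forall>m\<in>Poly_Mapping.keys f. monomial m \<in> J)"

lemma monomially_closed_mult: "monomially_closed J \<Longrightarrow> f \<in> J \<Longrightarrow> g * f \<in> J"
  by (simp add: monomially_closed_def module.subspace_def[OF module_mult])

lemma monomially_closed_if_monomial_ideal:
  assumes "monomial_ideal I"
  shows "monomially_closed I"
proof -
  obtain M where I: "I = module.span (*) (monomial ` M)"
    using assms by (auto simp: monomial_ideal_def ideal_gen_def)
  have sub: "module.subspace (*) I"
    unfolding I by (rule module.subspace_span[OF module_mult])
  note subD = sub[unfolded module.subspace_def[OF module_mult]]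
  \<comment> \<open>The members of \<open>I\<close> all of whose monomials lie in \<open>I\<close>
    form an ideal containing the generators, hence all of \<open>I\<close>.\<close>
  let ?T = "{f \<in> I. \<forall>m\<in>Poly_Mapping.keys f. monomial m \<in> I}"
  have "module.subspace (*) ?T"
    unfolding module.subspace_def[OF module_mult]
  proof (intro conjI ballI allI)
    show "0 \<in> ?T" using subD by simp
    show "f + g \<in> ?T" if "f \<in> ?T" "g \<in> ?T" for f g
      using that subD Poly_Mapping.keys_add[of f g] by blast
    show "c * f \<in> ?T" if f: "f \<in> ?T" for c f
    proof -
      have "monomial m \<in> I" if "m \<in> Poly_Mapping.keys (c * f)" for m
      proof -
        obtain k l where "m = k + l" "l \<in> Poly_Mapping.keys f"
          using keys_mult[of c f] \<open>m \<in> _\<close> by blast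
        then show ?thesis
          using f subD by (simp flip: monomial_mult)
      qed
      then show ?thesis using f subD by simp
    qed
  qed
  moreover have "monomial ` M \<subseteq> ?T"
    unfolding I by (auto simp: module.span_base[OF module_mult] monomial_def)
  ultimately have "I \<subseteq> ?T"
    using module.span_minimal[OF module_mult, of "monomial ` M" ?T] I by simp
  then show ?thesis
    using sub by (auto simp: monomially_closed_def)
qed

lemma monomially_closed_colon_var:
  assumes "monomially_closed J"
  shows "monomially_closed (colon J (var a))"
  unfolding monomially_closed_def
proof (intro conjI ballI)
  show "module.subspace (*) (colon J (var a))"
    using assms unfolding monomially_closed_def module.subspace_def[OF module_mult]
    by (simp add: colon_def distrib_left mult.left_commute)
  fix f m
  assume "f \<in> colon J (var a)" "m \<in> Poly_Mapping.keys f"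
  \<comment> \<open>Multiplication by a variable shifts exponents injectively, so no monomial of
    \<open>f\<close> is lost in the product.\<close>
  then have "var a * f \<in> J" "Poly_Mapping.single a 1 + m \<in> Poly_Mapping.keys (var a * f)"
    by (simp_all add: colon_def in_keys_iff var_def lookup_monomial_mult_shift)
  then have "monomial (Poly_Mapping.single a 1 + m) \<in> J"
    using assms by (simp add: monomially_closed_def)
  then show "monomial m \<in> colon J (var a)"
    by (simp add: colon_def var_def monomial_mult)
qed

section \<open>Links and cones from ideals\<close>

lemma down_closed_R:
  fixes J :: "'x::finite mpoly set"
  assumes "monomially_closed J"
  shows "down_closed (R J)"
  unfolding down_closed_def
proof (intro ballI allI impI)
  fix \<sigma> \<tau> :: "'x set" assume "\<sigma> \<in> R J" "\<tau> \<subseteq> \<sigma>"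
  have "face_mon \<sigma> = face_mon (\<sigma> - \<tau>) * face_mon \<tau>"
    using \<open>\<tau> \<subseteq> \<sigma>\<close> by (simp add: face_mon_def prod.subset_diff)
  then show "\<tau> \<in> R J"
    using \<open>\<sigma> \<in> R J\<close> monomially_closed_mult[OF assms] by (auto simp: R_def)
qed

text \<open>If \<open>a\<close> lies in \<sigma>, then the product of \<open>var a\<close> with the
  face monomial is divisible by the square of \<open>var a\<close> and so lies in \<open>J\<close>;
  otherwise it is the monomial of \<open>insert a \<sigma>\<close>.\<close>

lemma R_colon_var:
  fixes J :: "'x::finite mpoly set"
  assumes "monomially_closed J" "(var a)\<^sup>2 \<in> J"
  shows "R (colon J (var a)) = link (R J) a"
proof -
  have "var a * face_mon \<sigma> \<in> J" if "a \<in> \<sigma>" for \<sigma>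
  proof -
    have "var a * face_mon \<sigma> = face_mon (\<sigma> - {a}) * (var a)\<^sup>2"
      using face_mon_insert[of a "\<sigma> - {a}"] that
      by (simp add: insert_absorb power2_eq_square algebra_simps)
    then show ?thesis
      using assms by (simp add: monomially_closed_mult)
  qed
  then have "var a * face_mon \<sigma> \<notin> J \<longleftrightarrow> a \<notin> \<sigma> \<and> face_mon (insert a \<sigma>) \<notin> J" for \<sigma>
    by (metis face_mon_insert)
  then show ?thesis
    by (auto simp: R_def colon_def link_def)
qed

text \<open>The cone condition puts the face monomial into the ideal generated by \<open>J\<close>,
  \<open>a\<close> and \<open>b\<close>. Multiples of \<open>a\<close> and \<open>b\<close> cannot
  cancel it since \<sigma> avoids both, so it survives as a monomial of a member of
  \<open>J\<close>.\<close>

lemma face_mon_in_if_cone_apex: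
  fixes J :: "'x::finite mpoly set"
  assumes J: "monomially_closed J" and cone: "cone_apex (adjoin J (var a)) b"
    and "a \<notin> \<sigma>" "b \<notin> \<sigma>" and mem: "var b * face_mon \<sigma> \<in> adjoin J (var a)"
  shows "face_mon \<sigma> \<in> J"
proof -
  have adj: "f \<in> adjoin K (var x) \<longleftrightarrow> (\<exists>k. f - k * var x \<in> K)"
    if "module.subspace (*) K" for f x and K :: "'x mpoly set"
    unfolding adjoin_def ideal_gen_def module.span_insert[OF module_mult]
    using that module.span_eq_iff[OF module_mult, of K] by simp
  have sub: "module.subspace (*) J" "module.subspace (*) (adjoin J (var a))"
    using J module.subspace_span[OF module_mult]
    by (auto simp: monomially_closed_def adjoin_def ideal_gen_def)
  have "face_mon \<sigma> \<in> adjoin (adjoin J (var a)) (var b)"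
    using cone mem by (auto simp: cone_apex_def colon_def)
  then obtain k l where "face_mon \<sigma> - k * var b - l * var a \<in> J" (is "?g \<in> J")
    using adj sub by blast
  moreover have "face_coeff ?g \<sigma> = 1"
    using \<open>a \<notin> \<sigma>\<close> \<open>b \<notin> \<sigma>\<close> by (simp add: face_coeff_var_mult mult.commute[of _ "var _"])
  then have "face_exp \<sigma> \<in> Poly_Mapping.keys ?g"
    by (simp add: face_coeff_def in_keys_iff)
  ultimately show ?thesis
    using J unfolding monomially_closed_def face_mon_eq_monomial by blast
qed

text \<open>If the enlarged set were not a face, its monomial would lie in \<open>J\<close>, hence
  in \<open>adjoin J (var a)\<close>, and the cone condition would force \<sigma> out of
  \<open>R J\<close>.\<close>

lemma insert_in_R_if_dominates:
  fixes J :: "'x::finite mpoly set"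
  assumes "monomially_closed J" "dominates J a b" "\<sigma> \<in> R J" "a \<notin> \<sigma>"
  shows "insert b \<sigma> \<in> R J"
proof (cases "b \<in> \<sigma>")
  case True
  then show ?thesis using assms by (simp add: insert_absorb)
next
  case False
  have "J \<subseteq> adjoin J (var a)"
    unfolding adjoin_def ideal_gen_def using module.span_base[OF module_mult] by blast
  then show ?thesis
    using face_mon_in_if_cone_apex[of J a b \<sigma>] assms False
    by (auto simp: R_def dominates_def face_mon_insert)
qed

text \<open>If \<open>a = b\<close>, the cone condition applied to the empty face would put 1 into
  \<open>J\<close>.\<close>

lemma dominates_distinct:
  fixes J :: "'x::finite mpoly set"
  assumes "monomially_closed J" "dominates J a b" "var a \<notin> J"
  shows "a \<noteq> b"
proof
  assume "a = b"
  have "var a \<in> adjoin J (var a)"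
    unfolding adjoin_def ideal_gen_def using module.span_base[OF module_mult] by blast
  then have "1 \<in> J"
    using face_mon_in_if_cone_apex[of J a b "{}"] assms \<open>a = b\<close> by (simp add: dominates_def face_mon_def)
  then show False
    using monomially_closed_mult[OF assms(1), of 1 "var a"] assms(3) by simp
qed

section \<open>Resolutions as sequences of links\<close>

lemma step_ideal_0: "step_ideal I as 0 = I"
  by (simp add: step_ideal_def colon_def)

lemma step_ideal_Cons: "step_ideal I (a # as) (Suc i) = step_ideal (colon I (var a)) as i"
  by (simp add: step_ideal_def colon_def prod.lessThan_Suc_shift mult.assoc del: prod.lessThan_Suc)

text \<open>Induction over arbitrary monomially closed ideals containing the squares: both
  properties pass to the colon ideal by the first variable, whose step ideals are those of
  \<open>I\<close> shifted by one.\<close>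

lemma dominating_seq_R:
  fixes I :: "'x::finite mpoly set"
  assumes "length bs = length as" "monomially_closed I" "\<forall>x. (var x)\<^sup>2 \<in> I"
    and "\<forall>i<length as. var (as ! i) \<notin> step_ideal I as i"
    and "\<forall>i<length as. dominates (step_ideal I as i) (as ! i) (bs ! i)"
  shows "dominating_seq (R I) as bs \<and> R (core I as) = foldl link (R I) as"
  using assms
proof (induction bs as arbitrary: I rule: list_induct2)
  case Nil
  then show ?case by (simp add: core_def step_ideal_0)
next
  case (Cons b bs a as)
  let ?J = "colon I (var a)"
  have *: "var a \<notin> I" "dominates I a b"
    using Cons.prems(3,4) by (force simp: step_ideal_0)+
  have R: "R ?J = link (R I) a"
    using Cons.prems by (simp add: R_colon_var)
  have "dominating_seq (R ?J) as bs \<and> R (core ?J as) = foldl link (R ?J) as"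
  proof (rule Cons.IH)
    show "monomially_closed ?J"
      using Cons.prems by (simp add: monomially_closed_colon_var)
    show "\<forall>x. (var x)\<^sup>2 \<in> ?J"
      using Cons.prems by (simp add: colon_def monomially_closed_mult)
    show "\<forall>i<length as. var (as ! i) \<notin> step_ideal ?J as i"
         "\<forall>i<length as. dominates (step_ideal ?J as i) (as ! i) (bs ! i)"
      using Cons.prems(3,4) by (simp_all add: All_less_Suc2 step_ideal_Cons)
  qed
  then show ?case
    using * Cons.prems dominates_distinct[of I a b] insert_in_R_if_dominates[of I a b]
    by (simp add: R core_def step_ideal_Cons)
qed

theorem theorem4p5:
  fixes I :: "'x::finite mpoly set"
    and as bs :: "'x list"
    and ord :: "'x rel"
  assumes "monomial_ideal I"
    and "\<forall>x. (var x)\<^sup>2 \<in> I"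
    and "resolution I as"
    and "spherical I as"
    and "length bs = length as"
    and "\<forall>i<length as. dominates (step_ideal I as i) (as ! i) (bs ! i)"
    and "linear_order ord"
  shows "\<exists>\<phi> \<pi>. quasi_iso ord (length as) (R (core I as)) (R I) \<phi> \<and>
           face_sign_map (R I) \<pi> \<and>
           \<phi> = \<pi> \<circ> cross_mult as bs \<and>
           (adapted_order ord I as bs \<longrightarrow> \<pi> = id)"
proof -
  have closed: "monomially_closed I"
    using assms(1) by (rule monomially_closed_if_monomial_ideal)
  have dom: "dominating_seq (R I) as bs" and core: "R (core I as) = foldl link (R I) as"
    using dominating_seq_R[OF assms(5) closed assms(2)] assms(3,6) by (auto simp: resolution_def)
  have dc: "down_closed (R I)" "down_closed (R (core I as))"
    using closed by (auto simp: core down_closed_R down_closed_foldl_link)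
  have equiv: "homology_equiv ord (length as) (R (core I as)) (R I) (iter_suspend ord as bs)"
    unfolding core using assms(7) dc(1) dom by (rule homology_equiv_iter_suspend)
  \<comment> \<open>Allows any map agreeing with the iterated suspension on chains of the core to
    serve as \<phi>.\<close>
  have qi: "quasi_iso ord (length as) (R (core I as)) (R I) \<psi>"
    if "\<And>z. z \<in> chains (R (core I as)) \<Longrightarrow> iter_suspend ord as bs z = \<psi> z" for \<psi>
    using that by (intro quasi_iso_if_homology_equiv[OF assms(7) dc(2,1)] homology_equiv_cong[OF equiv])
      (simp add: cycles_def)
  show ?thesis
  \<comment> \<open>\<phi> is required to equal the composite on all polynomials, so it is taken to
    be that composite; \<pi> is the identity for adapted orders and \<open>sign_map\<close>
    otherwise.\<close>
  proof (cases "adapted_order ord I as bs")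
    case True
    define V where "V = {x. {x} \<in> R (core I as)}"
    have "refl ord"
      using assms(7) by (auto simp: linear_order_on_def partial_order_on_def preorder_on_def)
    \<comment> \<open>\<open>last bs\<close> may itself be a vertex of the core;
      \<open>adapted_order\<close> excludes that case, and reflexivity covers it.\<close>
    then have "(last bs, x) \<in> ord" if "as \<noteq> []" "x \<in> V" for x
      using True that by (cases "x = last bs") (auto simp: adapted_order_def V_def refl_on_def)
    then have asc: "ascending ord V as bs"
      using True assms(5,7) by (intro ascendingI) (auto simp: adapted_order_def)
    \<comment> \<open>The singletons of the elements of a face are again faces, so every face
      consists of vertices in \<open>V\<close>.\<close>
    have "R (core I as) \<subseteq> {\<sigma>. \<sigma> \<subseteq> V}"
      using dc(2) by (auto simp: V_def down_closed_def)
    then have "iter_suspend ord as bs z = cross_mult as bs z" if "z \<in> chains (R (core I as))" for z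
      using iter_suspend_eq_cross_mult[OF assms(7) asc] that chains_mono by blast
    from qi[OF this] show ?thesis
      by (intro exI[of _ "cross_mult as bs"] exI[of _ id]) (auto simp: face_sign_map_def additive_def)
  next
    case False
    have "iter_suspend ord as bs z = (sign_map ord as bs \<circ> cross_mult as bs) z"
      if "z \<in> chains (R (core I as))" for z
      using iter_suspend_eq_sign_map[OF dc(1) dom] that by (simp add: core)
    from qi[OF this] False show ?thesis
      using face_sign_map_sign_map by blast
  qed
qed

end
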